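(* Let $N$ be a finite set of $n \ge 1$ agents and $M$ a finite set of indivisible goods. Suppose each agent $i \in N$ has an additive valuation $v_i : 2^{M} \to \mathbb{R}_{\ge 0}$, and that there are at most three types of agents, i.e. $N$ can be partitioned into at most three groups such that agents in the same group have identical valuation functions (equivalently, $|\{v_i : i\in N\}| \le 3$). Then there exists an EFX allocation of $M$ among the agents, that is, a partition $X = \langle X_i\rangle_{i\in N}$ of $M$ into pairwise disjoint (possibly empty) bundles with $\bigcup_{i\in N} X_i = M$ such that for all $i,j\in N$ and all $g\in X_j$, $v_i(X_i)\ge v_i(X_j\setminus\{g\})$.
   Context: A valuation $v : 2^{M}\to\mathbb{R}_{\ge 0}$ is additive if $v(S)=\sum_{g\in S} v(\{g\})$ for every $S\subseteq M$ (so $v(\emptyset)=0$). The bundle $X_i$ is the set of goods given to agent $i$. An allocation is EFX (envy-free up to any good) if for all agents $i,j$ and every $g\in X_j$ one has $v_i(X_i)\ge v_i(X_j\setminus\{g\})$. *)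

theory Defs
  imports Complex_Main "HOL-Library.Disjoint_Sets"
begin

(* A valuation is a function on the subsets of M: its values on sets of goods that are
   not contained in M are unspecified and are never compared below. *)

definition valuation :: "'g set \<Rightarrow> ('g set \<Rightarrow> real) \<Rightarrow> bool" where
  "valuation M v \<longleftrightarrow> (\<forall>S\<subseteq>M. 0 \<le> v S)"

definition additive_valuation :: "'g set \<Rightarrow> ('g set \<Rightarrow> real) \<Rightarrow> bool" where
  "additive_valuation M v \<longleftrightarrow> valuation M v \<and> (\<forall>S\<subseteq>M. v S = (\<Sum>g\<in>S. v {g}))"

definition at_most_types :: "nat \<Rightarrow> 'a set \<Rightarrow> 'g set \<Rightarrow> ('a \<Rightarrow> 'g set \<Rightarrow> real) \<Rightarrow> bool" where
  "at_most_types k N M v \<longleftrightarrow>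
     (\<exists>P. partition_on N P \<and> finite P \<and> card P \<le> k \<and>
          (\<forall>G\<in>P. \<forall>i\<in>G. \<forall>j\<in>G. \<forall>S\<subseteq>M. v i S = v j S))"

(* Bundles may be empty, so the indexed family X, not its range, partitions M. *)

definition allocation :: "'a set \<Rightarrow> 'g set \<Rightarrow> ('a \<Rightarrow> 'g set) \<Rightarrow> bool" where
  "allocation N M X \<longleftrightarrow> disjoint_family_on X N \<and> (\<Union>i\<in>N. X i) = M"

definition EFX :: "'a set \<Rightarrow> ('a \<Rightarrow> 'g set \<Rightarrow> real) \<Rightarrow> ('a \<Rightarrow> 'g set) \<Rightarrow> bool" where
  "EFX N v X \<longleftrightarrow> (\<forall>i\<in>N. \<forall>j\<in>N. \<forall>g\<in>X j. v i (X i) \<ge> v i (X j - {g}))"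

end

theory Submission
  imports Defs "HOL-Library.Nat_Bijection"
begin

text \<open>
  After a perturbation the valuations are additive, positive and injective on bundles; if there are
  fewer goods than agents, one good per agent suffices. Call the three types \<open>a\<close>, \<open>b\<close>, \<open>c\<close>, with
  \<open>a\<close> occurring. Among the partial EFX allocations with prescribed numbers of agents of each
  type, the decisive quantity is the least value received by an agent of type \<open>a\<close>, its
  level. By induction on the number of agents of types \<open>b\<close> and \<open>c\<close>, the level of every
  partial EFX allocation is attained or exceeded by a complete one. For the step let \<open>\<alpha>\<close> be the
  largest level of partial EFX allocations for the given numbers, or for the numbers in which one agent
  of type \<open>b\<close> or \<open>c\<close> has been turned into an agent of type \<open>a\<close>.

  If only the given numbers reach \<open>\<alpha>\<close>, an allocation of level \<open>\<alpha>\<close> with the largest sum of the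
  least values for \<open>b\<close> and \<open>c\<close> is complete: a free good could be exchanged between the poorest
  agents of these two types. Otherwise there is a complete allocation of level \<open>\<alpha>\<close> with one more
  agent of type \<open>a\<close> and, say, one less of type \<open>c\<close>, and one can arrange that the agents of type
  \<open>c\<close> do not all own what a newcomer of type \<open>c\<close> would envy. Either the types can be
  reassigned to the bundles as they are, or moving a single good to the poorest agent of type
  \<open>a\<close> gives a partial EFX allocation of level above \<open>\<alpha>\<close>, which is impossible.
\<close>

section \<open>Extremal choices over finite sets, and levels\<close>

lemma ex_max_finite_image:
  fixes f :: "'s \<Rightarrow> real"
  assumes "P s" and "finite (f ` {s. P s})"
  obtains t where "P t" "\<And>u. P u \<Longrightarrow> f u \<le> f t"
proof -
  let ?m = "Max (f ` {s. P s})"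
  have "?m \<in> f ` {s. P s}" using assms by (intro Max_in) auto
  then obtain t where "P t" "f t = ?m" by auto
  moreover have "f u \<le> ?m" if "P u" for u using that assms(2) by (intro Max_ge) auto
  ultimately show thesis using that by auto
qed

lemma minimal_good_subset:
  assumes "finite R" "G R" "\<not> G {}"
  obtains S where "S \<subseteq> R" "S \<noteq> {}" "G S" "\<And>g. g \<in> S \<Longrightarrow> \<not> G (S - {g})"
proof -
  obtain S where S: "S \<subseteq> R" "G S" and min: "\<And>T. T \<subseteq> R \<and> G T \<Longrightarrow> card S \<le> card T"
    using ex_has_least_nat[of "\<lambda>T. T \<subseteq> R \<and> G T" R card] assms(2) by blast
  have "\<not> G (S - {g})" if "g \<in> S" for g
  proof
    assume "G (S - {g})"
    then have "card S \<le> card (S - {g})" using S(1) by (intro min) auto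
    moreover have "card (S - {g}) < card S"
      using that S(1) assms(1) by (meson card_Diff1_less finite_subset)
    ultimately show False by simp
  qed
  then show thesis using S assms(3) that by (metis)
qed

lemma card_exchange:
  assumes "finite S" "x \<in> S" "y \<notin> S"
  shows "card (insert y (S - {x})) = card S"
proof -
  have "card (insert y (S - {x})) = Suc (card (S - {x}))" using assms by simp
  then show ?thesis using card_Suc_Diff1[OF assms(1,2)] by simp
qed

text \<open>The value \<open>sum w M + 1\<close>, out of reach for every bundle, is the level of a type without
  agents.\<close>

definition level :: "'g set \<Rightarrow> ('g \<Rightarrow> real) \<Rightarrow> 'i set \<Rightarrow> ('i \<Rightarrow> 'g set) \<Rightarrow> real" where
  "level M w S X = Min (insert (sum w M + 1) ((\<lambda>i. sum w (X i)) ` S))"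

lemma level_le: "finite S \<Longrightarrow> i \<in> S \<Longrightarrow> level M w S X \<le> sum w (X i)"
  unfolding level_def by (intro Min_le) auto

lemma level_greater:
  "finite S \<Longrightarrow> x < sum w M + 1 \<Longrightarrow> (\<And>i. i \<in> S \<Longrightarrow> x < sum w (X i)) \<Longrightarrow> x < level M w S X"
  unfolding level_def by (subst Min_gr_iff) auto

lemma level_ge:
  "finite S \<Longrightarrow> x \<le> sum w M + 1 \<Longrightarrow> (\<And>i. i \<in> S \<Longrightarrow> x \<le> sum w (X i)) \<Longrightarrow> x \<le> level M w S X"
  unfolding level_def by (subst Min_ge_iff) auto

lemma level_attained:
  assumes "finite S" "level M w S X < sum w M + 1"
  obtains i where "i \<in> S" "sum w (X i) = level M w S X"
proof -
  have "level M w S X \<in> insert (sum w M + 1) ((\<lambda>i. sum w (X i)) ` S)"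
    unfolding level_def using assms(1) by (intro Min_in) auto
  then show thesis using assms(2) that by auto
qed

text \<open>A finite range of possible levels, depending only on \<open>M\<close> and
  \<open>w\<close>, makes the later maximisations legitimate although the families \<open>X\<close>
  are arbitrary outside \<open>N\<close>.\<close>

lemma level_in:
  assumes "finite S" "\<And>i. i \<in> S \<Longrightarrow> X i \<subseteq> M"
  shows "level M w S X \<in> insert (sum w M + 1) (sum w ` Pow M)"
proof -
  have "level M w S X \<in> insert (sum w M + 1) ((\<lambda>i. sum w (X i)) ` S)"
    unfolding level_def using assms(1) by (intro Min_in) auto
  then show ?thesis using assms(2) by auto
qed

section \<open>Safe families of bundles and configurations\<close>

locale three_valuations =
  fixes M :: "'g set" and N :: "'i set" and a b c :: "'g \<Rightarrow> real"
  assumes finM: "finite M" and finN: "finite N"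
    and pos: "\<And>g. g \<in> M \<Longrightarrow> 0 < a g" "\<And>g. g \<in> M \<Longrightarrow> 0 < b g" "\<And>g. g \<in> M \<Longrightarrow> 0 < c g"
    and inj: "inj_on (sum a) (Pow M)" "inj_on (sum b) (Pow M)" "inj_on (sum c) (Pow M)"
begin

definition safe :: "real \<Rightarrow> real \<Rightarrow> real \<Rightarrow> 'g set \<Rightarrow> bool" where
  "safe \<alpha> \<beta> \<gamma> S \<longleftrightarrow>
     (\<forall>g\<in>S. sum a (S - {g}) \<le> \<alpha> \<and> sum b (S - {g}) \<le> \<beta> \<and> sum c (S - {g}) \<le> \<gamma>)"

text \<open>Nonemptiness gives every bundle a positive value, makes disjoint bundles distinct as
  sets, and forces the bounds to be nonnegative as soon as there is an agent.\<close>

definition bundles :: "real \<Rightarrow> real \<Rightarrow> real \<Rightarrow> ('i \<Rightarrow> 'g set) \<Rightarrow> bool" where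
  "bundles \<alpha> \<beta> \<gamma> X \<longleftrightarrow> disjoint_family_on X N \<and>
     (\<forall>i\<in>N. X i \<subseteq> M \<and> X i \<noteq> {} \<and> safe \<alpha> \<beta> \<gamma> (X i))"

text \<open>The bundles in \<open>B\<close> and \<open>C\<close> go to agents of types \<open>b\<close> and \<open>c\<close>, all others to agents of type
  \<open>a\<close>. Being safe for common levels makes such a family EFX, and it allows bundles to be replaced
  and types to be reassigned one at a time. The goods outside the bundles are unallocated.\<close>

definition config ::
  "real \<Rightarrow> real \<Rightarrow> real \<Rightarrow> 'i set \<Rightarrow> 'i set \<Rightarrow> ('i \<Rightarrow> 'g set) \<Rightarrow> bool" where
  "config \<alpha> \<beta> \<gamma> B C X \<longleftrightarrow> bundles \<alpha> \<beta> \<gamma> X \<and> B \<subseteq> N \<and> C \<subseteq> N \<and> B \<inter> C = {} \<and>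
     (\<forall>i\<in>N - B - C. \<alpha> \<le> sum a (X i)) \<and> (\<forall>i\<in>B. \<beta> \<le> sum b (X i)) \<and> (\<forall>i\<in>C. \<gamma> \<le> sum c (X i))"

lemma configI:
  assumes "bundles \<alpha> \<beta> \<gamma> X" "B \<subseteq> N" "C \<subseteq> N" "B \<inter> C = {}"
    "\<And>i. i \<in> N - B - C \<Longrightarrow> \<alpha> \<le> sum a (X i)"
    "\<And>i. i \<in> B \<Longrightarrow> \<beta> \<le> sum b (X i)" "\<And>i. i \<in> C \<Longrightarrow> \<gamma> \<le> sum c (X i)"
  shows "config \<alpha> \<beta> \<gamma> B C X"
  using assms unfolding config_def by simp

text \<open>The number \<open>x\<close> acts on both sides: agents of type \<open>a\<close> receive
  at least \<open>x\<close>, and no bundle minus one good is worth more than \<open>x\<close> to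
  them. So a smaller number is not reached automatically. Types enter only through their numbers,
  since the indices in \<open>N\<close> name bundles; actual agents are matched with them at the
  very end.\<close>

definition reach :: "nat \<Rightarrow> nat \<Rightarrow> real \<Rightarrow> bool" where
  "reach q r x \<longleftrightarrow> (\<exists>\<beta> \<gamma> B C X. config x \<beta> \<gamma> B C X \<and> card B = q \<and> card C = r)"

definition reach_full :: "nat \<Rightarrow> nat \<Rightarrow> real \<Rightarrow> bool" where
  "reach_full q r x \<longleftrightarrow>
     (\<exists>\<beta> \<gamma> B C X. config x \<beta> \<gamma> B C X \<and> card B = q \<and> card C = r \<and> (\<Union>i\<in>N. X i) = M)"

lemma sum_mono_sub:
  assumes "S \<subseteq> T" "T \<subseteq> M"
  shows "sum a S \<le> sum a T" "sum b S \<le> sum b T" "sum c S \<le> sum c T"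
  using assms by (auto intro!: sum_mono2 finite_subset[OF assms(2) finM] less_imp_le[OF pos(1)]
      less_imp_le[OF pos(2)] less_imp_le[OF pos(3)])

lemma sum_positive:
  assumes "S \<subseteq> M" "S \<noteq> {}"
  shows "0 < sum a S" "0 < sum b S" "0 < sum c S"
  using assms finM pos by (auto intro!: sum_pos intro: finite_subset)

lemma sum_Diff_one:
  fixes w :: "'g \<Rightarrow> real"
  assumes "S \<subseteq> M" "g \<in> S"
  shows "sum w S = w g + sum w (S - {g})"
  by (rule sum.remove[OF finite_subset[OF assms(1) finM] assms(2)])

lemma sum_insert_free:
  fixes w :: "'g \<Rightarrow> real"
  assumes "S \<subseteq> M" "g \<notin> S"
  shows "sum w (insert g S) = w g + sum w S"
  by (rule sum.insert[OF finite_subset[OF assms(1) finM] assms(2)])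

lemma sum_split:
  fixes w :: "'g \<Rightarrow> real"
  assumes "T \<subseteq> M" "S \<subseteq> T"
  shows "sum w T = sum w S + sum w (T - S)"
  using sum.subset_diff[OF assms(2) finite_subset[OF assms(1) finM], of w] by simp

lemma sum_Un_split:
  fixes w :: "'g \<Rightarrow> real"
  assumes "S \<subseteq> M" "T \<subseteq> M" "S \<inter> T = {}"
  shows "sum w (S \<union> T) = sum w S + sum w T"
  by (rule sum.union_disjoint[OF finite_subset[OF assms(1) finM] finite_subset[OF assms(2) finM] assms(3)])

lemma safe_mono: "safe \<alpha> \<beta> \<gamma> S \<Longrightarrow> \<alpha> \<le> \<alpha>' \<Longrightarrow> \<beta> \<le> \<beta>' \<Longrightarrow> \<gamma> \<le> \<gamma>' \<Longrightarrow> safe \<alpha>' \<beta>' \<gamma>' S"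
  unfolding safe_def by (meson order_trans)

lemma safe_subset:
  assumes "safe \<alpha> \<beta> \<gamma> T" "S \<subseteq> T" "T \<subseteq> M"
  shows "safe \<alpha> \<beta> \<gamma> S"
  unfolding safe_def
proof
  fix g assume g: "g \<in> S"
  have "S - {g} \<subseteq> T - {g}" "T - {g} \<subseteq> M" using assms by auto
  from sum_mono_sub[OF this] show "sum a (S - {g}) \<le> \<alpha> \<and> sum b (S - {g}) \<le> \<beta> \<and> sum c (S - {g}) \<le> \<gamma>"
    using assms g unfolding safe_def by (meson order_trans subsetD)
qed

lemma bundlesD:
  assumes "bundles \<alpha> \<beta> \<gamma> X" "i \<in> N"
  shows "X i \<subseteq> M" "X i \<noteq> {}" "safe \<alpha> \<beta> \<gamma> (X i)" "\<And>j. j \<in> N \<Longrightarrow> i \<noteq> j \<Longrightarrow> X i \<inter> X j = {}"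
  using assms unfolding bundles_def disjoint_family_on_def by auto

text \<open>Disjoint nonempty sets differ, so injectivity on bundles rules out ties. Hence only one
  bundle of a type can attain its level, and improving that one bundle raises the level.\<close>

lemma bundles_distinct:
  assumes "bundles \<alpha> \<beta> \<gamma> X" "i \<in> N" "j \<in> N" "i \<noteq> j"
  shows "sum a (X i) \<noteq> sum a (X j)" "sum b (X i) \<noteq> sum b (X j)" "sum c (X i) \<noteq> sum c (X j)"
proof -
  have "X i \<inter> X j = {}" "X i \<noteq> {}" by (rule bundlesD(4)[OF assms], rule bundlesD(2)[OF assms(1,2)])
  then have "X i \<noteq> X j" by auto
  moreover have "X i \<in> Pow M" "X j \<in> Pow M" using bundlesD(1)[OF assms(1)] assms(2,3) by auto
  ultimately show "sum a (X i) \<noteq> sum a (X j)" "sum b (X i) \<noteq> sum b (X j)" "sum c (X i) \<noteq> sum c (X j)"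
    using inj_on_eq_iff[OF inj(1)] inj_on_eq_iff[OF inj(2)] inj_on_eq_iff[OF inj(3)] by auto
qed

lemma bundles_upd:
  assumes "bundles \<alpha> \<beta> \<gamma> X" "S \<subseteq> M" "S \<noteq> {}" "safe \<alpha> \<beta> \<gamma> S"
    and "\<And>j. j \<in> N \<Longrightarrow> j \<noteq> i \<Longrightarrow> S \<inter> X j = {}"
  shows "bundles \<alpha> \<beta> \<gamma> (X(i := S))"
  unfolding bundles_def disjoint_family_on_def
proof (intro conjI ballI impI)
  fix k l assume kl: "k \<in> N" "l \<in> N" "k \<noteq> l"
  have "X k \<inter> X l = {}" using bundlesD(4)[OF assms(1)] kl by auto
  then show "(X(i := S)) k \<inter> (X(i := S)) l = {}"
    using kl assms(5) by (cases "k = i"; cases "l = i") auto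
qed (use assms(2-4) bundlesD[OF assms(1)] in simp_all)

lemma bundles_upd2:
  assumes "bundles \<alpha> \<beta> \<gamma> X" "S \<subseteq> M" "S \<noteq> {}" "safe \<alpha> \<beta> \<gamma> S" "T \<subseteq> M" "T \<noteq> {}" "safe \<alpha> \<beta> \<gamma> T"
    and "S \<inter> T = {}" "i \<noteq> j"
    and "\<And>k. k \<in> N \<Longrightarrow> k \<noteq> i \<Longrightarrow> k \<noteq> j \<Longrightarrow> (S \<union> T) \<inter> X k = {}"
  shows "bundles \<alpha> \<beta> \<gamma> (X(i := S, j := T))"
  unfolding bundles_def disjoint_family_on_def
proof (intro conjI ballI impI)
  fix k l assume kl: "k \<in> N" "l \<in> N" "k \<noteq> l"
  have "X k \<inter> X l = {}" using bundlesD(4)[OF assms(1)] kl by auto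
  then show "(X(i := S, j := T)) k \<inter> (X(i := S, j := T)) l = {}"
    using kl assms(8-10) by (cases "k = i"; cases "k = j"; cases "l = i"; cases "l = j") auto
qed (use assms(2-7) bundlesD[OF assms(1)] in simp_all)

lemma config_reach:
  assumes "bundles \<alpha> \<beta> \<gamma> X" "B \<subseteq> N" "C \<subseteq> N" "B \<inter> C = {}"
    "\<And>i. i \<in> N - B - C \<Longrightarrow> \<alpha> \<le> sum a (X i)"
    "\<And>i. i \<in> B \<Longrightarrow> \<beta> \<le> sum b (X i)" "\<And>i. i \<in> C \<Longrightarrow> \<gamma> \<le> sum c (X i)"
    "card B = q" "card C = r"
  shows "reach q r \<alpha>"
  unfolding reach_def config_def using assms
  by (intro exI[of _ \<beta>] exI[of _ \<gamma>] exI[of _ B] exI[of _ C] exI[of _ X]) simp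

text \<open>Bounds may be raised to the values actually received: a bundle minus one good is worth
  at most the old bound, and every agent of the type gets at least that. For a type without agents
  the default value exceeds every bundle.\<close>

lemma config_levels:
  assumes "config \<alpha> \<beta> \<gamma> B C X"
  shows "config (level M a (N - B - C) X) (level M b B X) (level M c C X) B C X"
proof -
  have fin: "finite B" "finite C" "finite (N - B - C)"
    using assms finN finite_subset unfolding config_def by auto
  have bd: "bundles \<alpha> \<beta> \<gamma> X" and A: "\<And>i. i \<in> N - B - C \<Longrightarrow> \<alpha> \<le> sum a (X i)"
    and Bc: "\<And>i. i \<in> B \<Longrightarrow> \<beta> \<le> sum b (X i)" and Cc: "\<And>i. i \<in> C \<Longrightarrow> \<gamma> \<le> sum c (X i)"
    using assms unfolding config_def by blast+
  have "safe (level M a (N - B - C) X) (level M b B X) (level M c C X) (X i)" if "i \<in> N" for i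
    unfolding safe_def
  proof (intro ballI conjI)
    fix g assume g: "g \<in> X i"
    have sub: "X i - {g} \<subseteq> M" using bundlesD(1)[OF bd that] by auto
    note le = sum_mono_sub[OF sub order_refl]
    have s: "sum a (X i - {g}) \<le> \<alpha>" "sum b (X i - {g}) \<le> \<beta>" "sum c (X i - {g}) \<le> \<gamma>"
      using bundlesD(3)[OF bd that] g unfolding safe_def by auto
    have m: "sum a (X i - {g}) \<le> sum a M + 1" "sum b (X i - {g}) \<le> sum b M + 1"
      "sum c (X i - {g}) \<le> sum c M + 1" using le by linarith+
    show "sum a (X i - {g}) \<le> level M a (N - B - C) X"
      using fin(3) m(1) order_trans[OF s(1)] A by (intro level_ge) blast+
    show "sum b (X i - {g}) \<le> level M b B X"
      using fin(1) m(2) order_trans[OF s(2)] Bc by (intro level_ge) blast+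
    show "sum c (X i - {g}) \<le> level M c C X"
      using fin(2) m(3) order_trans[OF s(3)] Cc by (intro level_ge) blast+
  qed
  then have "bundles (level M a (N - B - C) X) (level M b B X) (level M c C X) X"
    using bd unfolding bundles_def by blast
  moreover have "B \<subseteq> N" "C \<subseteq> N" "B \<inter> C = {}" using assms unfolding config_def by auto
  ultimately show ?thesis
    unfolding config_def by (intro conjI ballI level_le fin)
qed

text \<open>The standard way to contradict maximality of \<open>\<alpha>\<close>. Passing to the
  level gives the larger number; since \<open>q + r < card N\<close> leaves an agent of type
  \<open>a\<close>, whose bundle is worth at most \<open>sum a M\<close>, \<open>\<alpha>\<close>
  lies below the default value as well.\<close>

lemma config_reach_greater:
  assumes "bundles \<alpha> \<beta> \<gamma> X" "B \<subseteq> N" "C \<subseteq> N" "B \<inter> C = {}"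
    "\<And>i. i \<in> N - B - C \<Longrightarrow> \<alpha> < sum a (X i)"
    "\<And>i. i \<in> B \<Longrightarrow> \<beta> \<le> sum b (X i)" "\<And>i. i \<in> C \<Longrightarrow> \<gamma> \<le> sum c (X i)"
    "card B = q" "card C = r" "q + r < card N"
  shows "\<exists>y>\<alpha>. reach q r y"
proof -
  have fin: "finite B" "finite C" using assms finN finite_subset by auto
  have "card (B \<union> C) < card N" using card_Un_le[of B C] assms(8-10) by simp
  then have "\<not> N \<subseteq> B \<union> C" using fin card_mono[of "B \<union> C" N] by auto
  then obtain i where i: "i \<in> N - B - C" by blast
  have "sum a (X i) \<le> sum a M" using bundlesD(1)[OF assms(1)] i by (intro sum_mono_sub) auto
  then have "\<alpha> < sum a M + 1" using assms(5)[OF i] by simp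
  then have "\<alpha> < level M a (N - B - C) X" using assms(5) finN by (intro level_greater) auto
  moreover have "config \<alpha> \<beta> \<gamma> B C X"
    unfolding config_def using assms(1-4,6,7) less_imp_le[OF assms(5)] by blast
  from config_levels[OF this] have "reach q r (level M a (N - B - C) X)"
    unfolding reach_def using assms(8,9) by metis
  ultimately show ?thesis by blast
qed

text \<open>Keeping \<open>\<alpha>\<close> while tightening the other two bounds allows the levels
  of \<open>b\<close> and \<open>c\<close> to be maximised for a fixed
  \<open>\<alpha>\<close>.\<close>

lemma config_levels_bc:
  assumes "config \<alpha> \<beta> \<gamma> B C X"
  shows "config \<alpha> (level M b B X) (level M c C X) B C X"
  using config_levels[OF assms] assms unfolding config_def bundles_def safe_def by simp

text \<open>Each bound dominates what is left of a nonempty bundle after removing a good.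
  Nonnegative bounds ensure that the empty set never strictly improves on them, as
  \<open>safe_claim\<close> requires.\<close>

lemma bundles_nonneg:
  assumes "bundles \<alpha> \<beta> \<gamma> X" "i \<in> N"
  shows "0 \<le> \<alpha>" "0 \<le> \<beta>" "0 \<le> \<gamma>"
proof -
  obtain g where g: "g \<in> X i" using bundlesD(2)[OF assms] by blast
  have "X i - {g} \<subseteq> M" using bundlesD(1)[OF assms] by blast
  note * = sum_mono_sub[OF empty_subsetI this]
  show "0 \<le> \<alpha>" "0 \<le> \<beta>" "0 \<le> \<gamma>"
    using * bundlesD(3)[OF assms] g unfolding safe_def by fastforce+
qed

text \<open>In a minimal set with property \<open>G\<close> the removal of any good destroys
  \<open>G\<close>, which bounds all three values; so minimality yields safety. In the applications
  \<open>G\<close> says that some type is pleased, so every pleasing set contains a safe pleasing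
  one.\<close>

lemma safe_claim:
  assumes "R \<subseteq> M" "G R" "\<not> G {}"
    and "\<And>S. \<not> G S \<Longrightarrow> sum a S \<le> \<alpha> \<and> sum b S \<le> \<beta> \<and> sum c S \<le> \<gamma>"
  shows "\<exists>S\<subseteq>R. S \<noteq> {} \<and> safe \<alpha> \<beta> \<gamma> S \<and> G S"
proof -
  obtain S where "S \<subseteq> R" "S \<noteq> {}" "G S" "\<And>g. g \<in> S \<Longrightarrow> \<not> G (S - {g})"
    by (rule minimal_good_subset[of R G, OF finite_subset[OF assms(1) finM] assms(2,3)]) blast
  then show ?thesis using assms(4) unfolding safe_def by blast
qed

lemma disjoint_from_others:
  assumes "bundles \<alpha> \<beta> \<gamma> X" "i \<in> N" "j \<in> N" "i \<noteq> j" "S \<subseteq> X i \<union> F" "F \<inter> (\<Union>k\<in>N. X k) = {}"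
  shows "S \<inter> X j = {}"
  using bundlesD(4)[OF assms(1-4)] assms(3,5,6) by blast

section \<open>Completion when only the given numbers of types reach the top level\<close>

lemma level_le_total: "finite S \<Longrightarrow> level M w S X \<le> sum w M + 1"
  unfolding level_def by (intro Min_le) auto

text \<open>Let \<open>b1\<close> and \<open>c1\<close> be the poorest agents of their types and \<open>g\<close> a free good. Minimal
  improving subsets \<open>Sb\<close> of \<open>X b1 \<union> {g}\<close> and \<open>Sc\<close> of \<open>X c1 \<union> {g}\<close> can only please the respective
  other type, but both need \<open>g\<close>. In \<open>Sc\<close> the good is therefore replaced by what \<open>Sb\<close> leaves
  of \<open>X b1\<close>: to \<open>b\<close> this is worth at least as much as \<open>g\<close>, to \<open>c\<close> less.\<close>

lemma full_if_top_only:
  assumes top: "\<And>y. \<alpha> < y \<Longrightarrow> \<not> reach q r y" and ex: "reach q r \<alpha>" and qr: "q + r < card N"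
    and noc: "\<And>r'. r = Suc r' \<Longrightarrow> \<not> reach q r' \<alpha>"
    and nob: "\<And>q'. q = Suc q' \<Longrightarrow> \<not> reach q' r \<alpha>"
  shows "reach_full q r \<alpha>"
proof -
  define P where "P = (\<lambda>(B :: 'i set, C :: 'i set, X :: 'i \<Rightarrow> 'g set). card B = q \<and> card C = r \<and>
    config \<alpha> (level M b B X) (level M c C X) B C X)"
  define f where "f = (\<lambda>(B :: 'i set, C :: 'i set, X :: 'i \<Rightarrow> 'g set). level M b B X + level M c C X)"
  obtain s where "P s"
    using ex config_levels_bc unfolding reach_def P_def by fastforce
  moreover have "finite (f ` {s. P s})"
  proof (rule finite_subset)
    let ?V = "insert (sum b M + 1) (sum b ` Pow M) \<times> insert (sum c M + 1) (sum c ` Pow M)"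
    show "f ` {s. P s} \<subseteq> (\<lambda>(x, y). x + y) ` ?V"
    proof clarify
      fix B C X assume "P (B, C, X)"
      then have cf: "config \<alpha> (level M b B X) (level M c C X) B C X" unfolding P_def by simp
      then have sub: "B \<subseteq> N" "C \<subseteq> N" "\<And>i. i \<in> N \<Longrightarrow> X i \<subseteq> M"
        unfolding config_def bundles_def by auto
      have "level M b B X \<in> insert (sum b M + 1) (sum b ` Pow M)"
        using sub finite_subset[OF sub(1) finN] by (intro level_in) auto
      moreover have "level M c C X \<in> insert (sum c M + 1) (sum c ` Pow M)"
        using sub finite_subset[OF sub(2) finN] by (intro level_in) auto
      ultimately have "(level M b B X, level M c C X) \<in> ?V" by (rule SigmaI)
      from imageI[OF this, of "\<lambda>(x, y). x + y"]
      show "f (B, C, X) \<in> (\<lambda>(x, y). x + y) ` ?V" unfolding f_def by simp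
    qed
    show "finite ((\<lambda>(x, y). x + y) ` ?V)" using finM by (intro finite_imageI finite_cartesian_product) auto
  qed
  ultimately obtain t where "P t" and tmax: "\<And>u. P u \<Longrightarrow> f u \<le> f t"
    by (rule ex_max_finite_image) blast
  moreover obtain B C X where t: "t = (B, C, X)" by (metis surj_pair)
  ultimately have card: "card B = q" "card C = r"
    and conf: "config \<alpha> (level M b B X) (level M c C X) B C X" unfolding P_def by auto
  define \<beta> where "\<beta> = level M b B X"
  define \<gamma> where "\<gamma> = level M c C X"
  have bd: "bundles \<alpha> \<beta> \<gamma> X" and sub: "B \<subseteq> N" "C \<subseteq> N" "B \<inter> C = {}"
    and good: "\<And>i. i \<in> N - B - C \<Longrightarrow> \<alpha> \<le> sum a (X i)"
      "\<And>i. i \<in> B \<Longrightarrow> \<beta> \<le> sum b (X i)" "\<And>i. i \<in> C \<Longrightarrow> \<gamma> \<le> sum c (X i)"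
    using conf unfolding config_def \<beta>_def \<gamma>_def by auto
  have fin: "finite B" "finite C" using sub finN by (blast intro: finite_subset)+
  have better: "\<not> (\<beta> < level M b B' X' \<and> \<gamma> \<le> level M c C' X' \<or> \<beta> \<le> level M b B' X' \<and> \<gamma> < level M c C' X')"
    if "config \<alpha> \<beta> \<gamma> B' C' X'" "card B' = q" "card C' = r" for B' C' X'
  proof -
    have "P (B', C', X')" unfolding P_def using that config_levels_bc[OF that(1)] by simp
    from tmax[OF this] show ?thesis unfolding f_def t \<beta>_def \<gamma>_def by auto
  qed
  \<comment> \<open>One type improving strictly, with nothing lost elsewhere, contradicts the
    maximal sum of levels. The condition \<open>\<beta> < sum b M + 1\<close>, and likewise for
    \<open>\<gamma>\<close>, excludes a type without agents, whose level is the default value and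
    cannot rise.\<close>
  have no_improve: False
    if "bundles \<alpha> \<beta> \<gamma> X'" "B' \<subseteq> N" "C' \<subseteq> N" "B' \<inter> C' = {}" "card B' = q" "card C' = r"
      "\<And>i. i \<in> N - B' - C' \<Longrightarrow> \<alpha> \<le> sum a (X' i)"
      "\<And>i. i \<in> B' \<Longrightarrow> \<beta> \<le> sum b (X' i)" "\<And>i. i \<in> C' \<Longrightarrow> \<gamma> \<le> sum c (X' i)"
      "\<beta> < sum b M + 1 \<and> (\<forall>i\<in>B'. \<beta> < sum b (X' i)) \<or> \<gamma> < sum c M + 1 \<and> (\<forall>i\<in>C'. \<gamma> < sum c (X' i))"
    for B' C' X'
  proof -
    have cf: "config \<alpha> \<beta> \<gamma> B' C' X'" unfolding config_def using that(1-9) by simp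
    have fin': "finite B'" "finite C'" using that(2,3) finN by (blast intro: finite_subset)+
    have "\<beta> \<le> level M b B' X'" using fin' that(8) level_le_total[OF fin(1)] by (intro level_ge) (auto simp: \<beta>_def)
    moreover have "\<gamma> \<le> level M c C' X'" using fin' that(9) level_le_total[OF fin(2)] by (intro level_ge) (auto simp: \<gamma>_def)
    moreover have "\<beta> < level M b B' X' \<or> \<gamma> < level M c C' X'"
      using that(10) level_greater[OF fin'(1)] level_greater[OF fin'(2)] by blast
    ultimately show False using better[OF cf that(5,6)] by blast
  qed
  have "card (B \<union> C) < card N" using card_Un_le[of B C] card qr by simp
  then have "\<not> N \<subseteq> B \<union> C" using fin card_mono[of "B \<union> C" N] by auto
  then obtain i0 where i0: "i0 \<in> N - B - C" by blast
  note nonneg = bundles_nonneg[OF bd, of i0]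
  have "\<Union> (X ` N) = M"
  proof (rule ccontr)
    assume "\<Union> (X ` N) \<noteq> M"
    then obtain g where g: "g \<in> M" "g \<notin> \<Union> (X ` N)" using bundlesD(1)[OF bd] by blast
    have free: "{g} \<inter> \<Union> (X ` N) = {}" using g by auto
    have claim: "\<exists>S\<subseteq>R. S \<noteq> {} \<and> safe \<alpha> \<beta> \<gamma> S \<and> (\<alpha> < sum a S \<or> \<beta> < sum b S \<or> \<gamma> < sum c S)"
      if "R \<subseteq> M" "\<alpha> < sum a R \<or> \<beta> < sum b R \<or> \<gamma> < sum c R" for R
      using that nonneg i0 by (intro safe_claim) auto
    have R: "insert g (X i) \<subseteq> M" "g \<notin> X i" "\<And>S j. S \<subseteq> insert g (X i) \<Longrightarrow> j \<in> N \<Longrightarrow> j \<noteq> i \<Longrightarrow> S \<inter> X j = {}"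
      if "i \<in> N" for i
    proof -
      show "insert g (X i) \<subseteq> M" "g \<notin> X i" using bundlesD(1)[OF bd that] g that by auto
      show "S \<inter> X j = {}" if "S \<subseteq> insert g (X i)" "j \<in> N" "j \<noteq> i" for S j
        using disjoint_from_others[OF bd \<open>i \<in> N\<close> that(2) that(3)[symmetric] _ free] that(1) by auto
    qed
    have lt: "sum b S < sum b M + 1" "sum c S < sum c M + 1" if "S \<subseteq> M" for S
      using sum_mono_sub(2,3)[OF that order_refl] by auto
    have C_case: "\<exists>c1 S. c1 \<in> C \<and> sum c (X c1) = \<gamma> \<and> S \<subseteq> insert g (X c1) \<and> S \<noteq> {} \<and> safe \<alpha> \<beta> \<gamma> S
        \<and> \<beta> < sum b S \<and> sum c S \<le> \<gamma>" if C0: "C \<noteq> {}"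
    proof -
      obtain c0 where c0: "c0 \<in> C" using C0 by blast
      have "\<gamma> < sum c M + 1"
        using good(3)[OF c0] lt(2)[OF bundlesD(1)[OF bd], of c0] c0 sub by auto
      then obtain c1 where c1: "c1 \<in> C" "sum c (X c1) = \<gamma>" using level_attained[OF fin(2)] unfolding \<gamma>_def by blast
      then have c1N: "c1 \<in> N" using sub by auto
      have others: "\<gamma> < sum c (X i)" if "i \<in> C - {c1}" for i
        using good(3)[of i] bundles_distinct(3)[OF bd c1N, of i] that c1 sub by force
      have "\<gamma> < sum c (insert g (X c1))"
        using sum_insert_free[of "X c1" g c] bundlesD(1)[OF bd c1N] R(2)[OF c1N] pos(3)[OF g(1)] c1 by simp
      then obtain S where S: "S \<subseteq> insert g (X c1)" "S \<noteq> {}" "safe \<alpha> \<beta> \<gamma> S"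
          "\<alpha> < sum a S \<or> \<beta> < sum b S \<or> \<gamma> < sum c S"
        using claim[OF R(1)[OF c1N]] by blast
      have SM: "S \<subseteq> M" using S(1) R(1)[OF c1N] by blast
      have bd': "bundles \<alpha> \<beta> \<gamma> (X(c1 := S))"
        by (rule bundles_upd[OF bd SM S(2,3)]) (rule R(3)[OF c1N S(1)])
      have "\<not> \<alpha> < sum a S"
      proof
        assume "\<alpha> < sum a S"
        then have "reach q (r - 1) \<alpha>"
          using sub good c1 card fin by (intro config_reach[OF bd', where B=B and C="C - {c1}"]) auto
        moreover have "r = Suc (r - 1)" using card c1 fin by (metis Suc_pred' card_gt_0_iff empty_iff)
        ultimately show False using noc by blast
      qed
      moreover have "\<not> \<gamma> < sum c S"
      proof
        assume "\<gamma> < sum c S"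
        show False
        proof (rule no_improve[OF bd' sub card])
          show "\<beta> < sum b M + 1 \<and> (\<forall>i\<in>B. \<beta> < sum b ((X(c1 := S)) i)) \<or>
            \<gamma> < sum c M + 1 \<and> (\<forall>i\<in>C. \<gamma> < sum c ((X(c1 := S)) i))"
            using \<open>\<gamma> < sum c M + 1\<close> \<open>\<gamma> < sum c S\<close> others by auto
        qed (use good sub c1 \<open>\<gamma> < sum c S\<close> in auto)
      qed
      ultimately show ?thesis using S c1 by (intro exI[of _ c1] exI[of _ S]) auto
    qed
    have B_case: "\<exists>b1 S. b1 \<in> B \<and> sum b (X b1) = \<beta> \<and> S \<subseteq> insert g (X b1) \<and> S \<noteq> {} \<and> safe \<alpha> \<beta> \<gamma> S
        \<and> \<gamma> < sum c S \<and> sum b S \<le> \<beta>" if B0: "B \<noteq> {}"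
    proof -
      obtain b0 where b0: "b0 \<in> B" using B0 by blast
      have "\<beta> < sum b M + 1"
        using good(2)[OF b0] lt(1)[OF bundlesD(1)[OF bd], of b0] b0 sub by auto
      then obtain b1 where b1: "b1 \<in> B" "sum b (X b1) = \<beta>" using level_attained[OF fin(1)] unfolding \<beta>_def by blast
      then have b1N: "b1 \<in> N" using sub by auto
      have others: "\<beta> < sum b (X i)" if "i \<in> B - {b1}" for i
        using good(2)[of i] bundles_distinct(2)[OF bd b1N, of i] that b1 sub by force
      have "\<beta> < sum b (insert g (X b1))"
        using sum_insert_free[of "X b1" g b] bundlesD(1)[OF bd b1N] R(2)[OF b1N] pos(2)[OF g(1)] b1 by simp
      then obtain S where S: "S \<subseteq> insert g (X b1)" "S \<noteq> {}" "safe \<alpha> \<beta> \<gamma> S"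
          "\<alpha> < sum a S \<or> \<beta> < sum b S \<or> \<gamma> < sum c S"
        using claim[OF R(1)[OF b1N]] by blast
      have SM: "S \<subseteq> M" using S(1) R(1)[OF b1N] by blast
      have bd': "bundles \<alpha> \<beta> \<gamma> (X(b1 := S))"
        by (rule bundles_upd[OF bd SM S(2,3)]) (rule R(3)[OF b1N S(1)])
      have "\<not> \<alpha> < sum a S"
      proof
        assume "\<alpha> < sum a S"
        then have "reach (q - 1) r \<alpha>"
          using sub good b1 card fin by (intro config_reach[OF bd', where B="B - {b1}" and C=C]) auto
        moreover have "q = Suc (q - 1)" using card b1 fin by (metis Suc_pred' card_gt_0_iff empty_iff)
        ultimately show False using nob by blast
      qed
      moreover have "\<not> \<beta> < sum b S"
      proof
        assume "\<beta> < sum b S"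
        show False
        proof (rule no_improve[OF bd' sub card])
          show "\<beta> < sum b M + 1 \<and> (\<forall>i\<in>B. \<beta> < sum b ((X(b1 := S)) i)) \<or>
            \<gamma> < sum c M + 1 \<and> (\<forall>i\<in>C. \<gamma> < sum c ((X(b1 := S)) i))"
            using \<open>\<beta> < sum b M + 1\<close> \<open>\<beta> < sum b S\<close> others by auto
        qed (use good sub b1 \<open>\<beta> < sum b S\<close> in auto)
      qed
      ultimately show ?thesis using S b1 by (intro exI[of _ b1] exI[of _ S]) auto
    qed
    show False
    proof (cases "B = {} \<and> C = {}")
      \<comment> \<open>With agents of type \<open>a\<close> alone, the other two bounds are the
        default values, which no set exceeds. So an improvement of the poorest agent pleases
        \<open>a\<close> and raises the level beyond \<open>\<alpha>\<close>.\<close>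
      case True
      then have "\<beta> = sum b M + 1" "\<gamma> = sum c M + 1" unfolding \<beta>_def \<gamma>_def level_def by auto
      then have nbc: "\<not> \<beta> < sum b S" "\<not> \<gamma> < sum c S" if "S \<subseteq> M" for S using lt[OF that] by auto
      obtain a1 where a1: "a1 \<in> N" "sum a (X a1) \<le> \<alpha>"
      proof (rule ccontr)
        assume "\<not> thesis"
        then have "\<And>i. i \<in> N - B - C \<Longrightarrow> \<alpha> < sum a (X i)" using that by force
        from config_reach_greater[OF bd sub this good(2,3) card qr] top show False by blast
      qed
      then have eq: "sum a (X a1) = \<alpha>" using good(1) True by force
      have "\<alpha> < sum a (insert g (X a1))"
        using sum_insert_free[of "X a1" g a] bundlesD(1)[OF bd a1(1)] R(2)[OF a1(1)] pos(1)[OF g(1)] eq by simp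
      then obtain S where S: "S \<subseteq> insert g (X a1)" "S \<noteq> {}" "safe \<alpha> \<beta> \<gamma> S"
          "\<alpha> < sum a S \<or> \<beta> < sum b S \<or> \<gamma> < sum c S"
        using claim[OF R(1)[OF a1(1)]] by blast
      have SM: "S \<subseteq> M" using S(1) R(1)[OF a1(1)] by blast
      have bd': "bundles \<alpha> \<beta> \<gamma> (X(a1 := S))"
        by (rule bundles_upd[OF bd SM S(2,3)]) (rule R(3)[OF a1(1) S(1)])
      have "\<alpha> < sum a ((X(a1 := S)) i)" if "i \<in> N - B - C" for i
        using S(4) nbc[OF SM] good(1)[OF that] bundles_distinct(1)[OF bd a1(1), of i] that eq
        by (cases "i = a1") force+
      from config_reach_greater[OF bd' sub this _ _ card qr] top True show False by force
    next
      case False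
      \<comment> \<open>If only one of the two types occurred, its pleasing set would have to exceed
        the default bound of the other.\<close>
      have "B \<noteq> {}"
      proof
        assume "B = {}"
        then have "\<beta> = sum b M + 1" unfolding \<beta>_def level_def by simp
        moreover obtain c1 S where "c1 \<in> C" "S \<subseteq> insert g (X c1)" "\<beta> < sum b S"
          using C_case False \<open>B = {}\<close> by blast
        moreover have "S \<subseteq> M" using R(1)[of c1] calculation sub by blast
        ultimately show False using lt(1)[of S] by simp
      qed
      moreover have "C \<noteq> {}"
      proof
        assume "C = {}"
        then have "\<gamma> = sum c M + 1" unfolding \<gamma>_def level_def by simp
        moreover obtain b1 S where "b1 \<in> B" "S \<subseteq> insert g (X b1)" "\<gamma> < sum c S"
          using B_case \<open>B \<noteq> {}\<close> by blast
        moreover have "S \<subseteq> M" using R(1)[of b1] calculation sub by blast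
        ultimately show False using lt(2)[of S] by simp
      qed
      ultimately obtain b1 Sb c1 Sc
        where b1: "b1 \<in> B" "sum b (X b1) = \<beta>" and Sb: "Sb \<subseteq> insert g (X b1)" "Sb \<noteq> {}" "safe \<alpha> \<beta> \<gamma> Sb"
          "\<gamma> < sum c Sb" "sum b Sb \<le> \<beta>"
          and c1: "c1 \<in> C" "sum c (X c1) = \<gamma>" and Sc: "Sc \<subseteq> insert g (X c1)" "Sc \<noteq> {}" "safe \<alpha> \<beta> \<gamma> Sc"
          "\<beta> < sum b Sc" "sum c Sc \<le> \<gamma>"
        using B_case C_case by metis
      have bcN: "b1 \<in> N" "c1 \<in> N" "b1 \<noteq> c1" using b1 c1 sub by auto
      have XM: "X b1 \<subseteq> M" "X c1 \<subseteq> M" using bundlesD(1)[OF bd] bcN by auto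
      have gX: "g \<notin> X b1" "g \<notin> X c1" using R(2) bcN by auto
      have dis: "X b1 \<inter> X c1 = {}" using bundlesD(4)[OF bd bcN] .
      have SM: "Sb \<subseteq> M" "Sc \<subseteq> M" using Sb(1) Sc(1) R(1) bcN by blast+
      have othB: "\<beta> < sum b (X i)" if "i \<in> B - {b1}" for i
        using good(2)[of i] bundles_distinct(2)[OF bd bcN(1), of i] that b1 sub by force
      have othC: "\<gamma> < sum c (X i)" if "i \<in> C - {c1}" for i
        using good(3)[of i] bundles_distinct(3)[OF bd bcN(2), of i] that c1 sub by force
      have ltM: "\<beta> < sum b M + 1" "\<gamma> < sum c M + 1" using lt(1)[OF SM(2)] lt(2)[OF SM(1)] Sb(4) Sc(4) by linarith+
      \<comment> \<open>Otherwise the bundles at \<open>b1\<close> and \<open>c1\<close> exchange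
        types: \<open>Sc\<close> serves type \<open>b\<close> and \<open>X b1\<close> serves type
        \<open>c\<close>, improving both.\<close>
      have cb: "sum c (X b1) \<le> \<gamma>"
      proof (rule ccontr)
        assume "\<not> sum c (X b1) \<le> \<gamma>"
        then have n: "\<gamma> < sum c (X b1)" by simp
        have bd': "bundles \<alpha> \<beta> \<gamma> (X(c1 := Sc))"
          by (rule bundles_upd[OF bd SM(2) Sc(2,3)]) (rule R(3)[OF bcN(2) Sc(1)])
        show False
        proof (rule no_improve[OF bd', where B'="insert c1 (B - {b1})" and C'="insert b1 (C - {c1})"])
          show "card (insert c1 (B - {b1})) = q" "card (insert b1 (C - {c1})) = r"
            using card_exchange[OF fin(1) b1(1), of c1] card_exchange[OF fin(2) c1(1), of b1] card b1(1) c1(1) sub(3)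
            by auto
        qed (use n good sub b1 c1 bcN Sc othB othC ltM in \<open>auto intro: less_imp_le\<close>)
      qed
      have gSb: "g \<in> Sb" using Sb(1,4) cb sum_mono_sub(3)[of Sb "X b1"] XM by force
      \<comment> \<open>Without \<open>g\<close>, the set \<open>Sc\<close> would lie in
        \<open>X c1\<close>, so that \<open>X c1\<close> already pleases \<open>b\<close>. Then
        \<open>Sb\<close> could be given to type \<open>c\<close> and \<open>X c1\<close> to type
        \<open>b\<close>.\<close>
      have gSc: "g \<in> Sc" 
      proof (rule ccontr)
        assume "g \<notin> Sc"
        then have ScX: "Sc \<subseteq> X c1" using Sc(1) by auto
        have bd': "bundles \<alpha> \<beta> \<gamma> (X(b1 := Sb))"
          by (rule bundles_upd[OF bd SM(1) Sb(2,3)]) (rule R(3)[OF bcN(1) Sb(1)])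
        have n: "\<beta> < sum b (X c1)" using Sc(4) sum_mono_sub(2)[OF ScX XM(2)] by simp
        show False
        proof (rule no_improve[OF bd', where B'="insert c1 (B - {b1})" and C'="insert b1 (C - {c1})"])
          show "card (insert c1 (B - {b1})) = q" "card (insert b1 (C - {c1})) = r"
            using card_exchange[OF fin(1) b1(1), of c1] card_exchange[OF fin(2) c1(1), of b1] card b1(1) c1(1) sub(3)
            by auto
        qed (use n good sub b1 c1 bcN Sb othB othC ltM in \<open>auto intro: less_imp_le\<close>)
      qed
      define R0 where "R0 = (Sc - {g}) \<union> (X b1 - (Sb - {g}))"
      have subs: "Sb - {g} \<subseteq> X b1" "Sc - {g} \<subseteq> X c1" using Sb(1) Sc(1) by auto
      have R0M: "R0 \<subseteq> M" unfolding R0_def using subs XM by auto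
      have sums: "sum w R0 = sum w (Sc - {g}) + sum w (X b1 - (Sb - {g}))"
        "sum w (X b1) = sum w (Sb - {g}) + sum w (X b1 - (Sb - {g}))"
        "sum w Sb = w g + sum w (Sb - {g})" "sum w Sc = w g + sum w (Sc - {g})" for w :: "'g \<Rightarrow> real"
        unfolding R0_def
        by (rule sum_Un_split, use subs XM dis in auto)
          (rule sum_split[OF XM(1) subs(1)], rule sum_Diff_one[OF SM(1) gSb], rule sum_Diff_one[OF SM(2) gSc])
      have "\<beta> < sum b R0" using sums[of b] Sb(5) Sc(4) b1 by linarith
      then obtain S where S: "S \<subseteq> R0" "S \<noteq> {}" "safe \<alpha> \<beta> \<gamma> S"
          "\<alpha> < sum a S \<or> \<beta> < sum b S \<or> \<gamma> < sum c S"
        using claim[OF R0M] by blast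
      have "sum c R0 \<le> \<gamma>" using sums[of c] Sb(4) Sc(5) cb by linarith
      then have "\<not> \<gamma> < sum c S" using sum_mono_sub(3)[OF S(1) R0M] by simp
      \<comment> \<open>Type \<open>c\<close> now receives \<open>Sb\<close>, and \<open>S\<close>
        pleases \<open>a\<close> or \<open>b\<close>. In the first case index \<open>b1\<close>
        passes to type \<open>a\<close>, against \<open>nob\<close>; in the second the levels of
        both \<open>b\<close> and \<open>c\<close> rise.\<close>
      have bd': "bundles \<alpha> \<beta> \<gamma> (X(b1 := S, c1 := Sb))"
      proof (rule bundles_upd2[OF bd _ S(2,3) SM(1) Sb(2,3)])
        show "S \<subseteq> M" using S(1) R0M by auto
        show "S \<inter> Sb = {}" using S(1) subs gX dis unfolding R0_def by blast
        show "b1 \<noteq> c1" by (rule bcN)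
        fix k assume k: "k \<in> N" "k \<noteq> b1" "k \<noteq> c1"
        have "X b1 \<inter> X k = {}" "X c1 \<inter> X k = {}" "g \<notin> X k"
          using bundlesD(4)[OF bd bcN(1) k(1)] bundlesD(4)[OF bd bcN(2) k(1)] k g by auto
        then show "(S \<union> Sb) \<inter> X k = {}" using S(1) subs Sb(1) unfolding R0_def by blast
      qed
      show False
      proof (cases "\<alpha> < sum a S")
        case True
        have "reach (q - 1) r \<alpha>"
        proof (rule config_reach[OF bd', where B="B - {b1}" and C=C])
          show "B - {b1} \<subseteq> N" "C \<subseteq> N" "(B - {b1}) \<inter> C = {}" using sub by auto
          show "\<alpha> \<le> sum a ((X(b1 := S, c1 := Sb)) i)" if "i \<in> N - (B - {b1}) - C" for i
            using that True good(1)[of i] c1(1) bcN(3) by (cases "i = b1") auto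
          show "\<beta> \<le> sum b ((X(b1 := S, c1 := Sb)) i)" if "i \<in> B - {b1}" for i
            using that good(2)[of i] c1(1) sub(3) by auto
          show "\<gamma> \<le> sum c ((X(b1 := S, c1 := Sb)) i)" if "i \<in> C" for i
            using that good(3)[of i] b1(1) sub(3) Sb(4) by auto
        qed (use card b1(1) fin in simp_all)
        moreover have "q = Suc (q - 1)" using card b1 fin by (metis Suc_pred' card_gt_0_iff empty_iff)
        ultimately show False using nob by blast
      next
        case False
        then have n: "\<beta> < sum b S" using S(4) \<open>\<not> \<gamma> < sum c S\<close> by blast
        show False
        proof (rule no_improve[OF bd' sub card])
        qed (use n good sub b1 c1 bcN Sb othB othC ltM in \<open>auto intro: less_imp_le\<close>)
      qed
    qed
  qed
  then show ?thesis using conf card unfolding reach_full_def by blast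
qed

section \<open>Moving one good when the types cannot be reassigned\<close>

text \<open>The good that \<open>b\<close> values least in \<open>X k\<close>, or \<open>c\<close> in \<open>X l\<close>, moves to the poorest agent \<open>x\<close> of type \<open>a\<close>.
  In the only case not settled by this, both goods come from \<open>X h\<close>, and then a set containing \<open>gb\<close>
  that pleases \<open>b\<close> but not \<open>c\<close> still does so when \<open>gb\<close> is replaced by \<open>gc\<close>.\<close>

lemma exchange_aux:
  assumes bd: "bundles \<alpha> \<beta> \<gamma> X" and sub: "B \<subseteq> N" "C \<subseteq> N" "B \<inter> C = {}"
    and L: "\<And>i. i \<in> N - B - C \<Longrightarrow> \<alpha> \<le> sum a (X i)" "\<And>i. i \<in> N - B - C \<Longrightarrow> sum b (X i) < \<beta>"
      "\<And>i. i \<in> N - B - C \<Longrightarrow> sum c (X i) < \<gamma>"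
    and good: "\<And>i. i \<in> B \<Longrightarrow> \<beta> \<le> sum b (X i)" "\<And>i. i \<in> C \<Longrightarrow> \<gamma> \<le> sum c (X i)"
    and h: "h \<in> B" "\<gamma> \<le> sum c (X h)"
    and k: "k \<in> B" "gb \<in> X k" "sum b (X k - {gb}) = \<beta>"
    and l: "l \<in> insert h C" "gc \<in> X l" "sum c (X l - {gc}) = \<gamma>"
    and card: "card B = q" "card C = r" and qr: "q + Suc r < card N"
    and top: "\<And>y. \<alpha> < y \<Longrightarrow> \<not> reach q (Suc r) y" "\<And>y. \<alpha> < y \<Longrightarrow> \<not> reach q r y"
      "\<And>y. \<alpha> < y \<Longrightarrow> \<not> reach (q - 1) (Suc r) y"
  shows False
proof -
  have fin: "finite B" "finite C" using sub finN by (blast intro: finite_subset)+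
  obtain x where x: "x \<in> N - B - C" "sum a (X x) \<le> \<alpha>"
  proof (rule ccontr)
    assume "\<not> thesis"
    then have "\<And>i. i \<in> N - B - C \<Longrightarrow> \<alpha> < sum a (X i)" using that by force
    from config_reach_greater[OF bd sub this good card] qr top(2) show False by auto
  qed
  then have ax: "sum a (X x) = \<alpha>" using L(1) by force
  have xN: "x \<in> N" "x \<notin> B" "x \<notin> C" using x by auto
  have hN: "h \<in> N" "h \<notin> C" "h \<noteq> x" and kN: "k \<in> N" "k \<notin> C" "k \<noteq> x" and lN: "l \<in> N" "l \<noteq> x"
    using h k l sub xN by auto
  have others: "\<alpha> < sum a (X i)" if "i \<in> N - B - C" "i \<noteq> x" for i
    using L(1)[of i] bundles_distinct(1)[OF bd xN(1), of i] that ax by force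
  have XM: "X i \<subseteq> M" if "i \<in> N" for i using bundlesD(1)[OF bd that] .
  \<comment> \<open>Strict positivity comes from the nonempty bundle of \<open>x\<close>, worth less
    than \<open>\<beta>\<close> to \<open>b\<close> and less than \<open>\<gamma>\<close> to
    \<open>c\<close>. It is needed because pleasing \<open>b\<close> or \<open>c\<close> here means
    only attaining the bound, which the empty set must fail to do.\<close>
  have posl: "0 < \<beta>" "0 < \<gamma>" "0 \<le> \<alpha>"
    using sum_positive[OF XM[OF xN(1)] bundlesD(2)[OF bd xN(1)]] L(2,3)[OF x(1)] ax by auto
  have trim: "bundles \<alpha> \<beta> \<gamma> (X(j := X j - {g}, x := S))"
    if j: "j \<in> N" "j \<noteq> x" "g \<in> X j" "X j - {g} \<noteq> {}"
      and S: "S \<subseteq> insert g (X x)" "S \<noteq> {}" "safe \<alpha> \<beta> \<gamma> S" for j g S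
  proof (rule bundles_upd2[OF bd _ j(4) _ _ S(2,3)])
    show "X j - {g} \<subseteq> M" using XM[OF j(1)] by auto
    show "safe \<alpha> \<beta> \<gamma> (X j - {g})"
      by (rule safe_subset[OF bundlesD(3)[OF bd j(1)] _ XM[OF j(1)]]) auto
    show "S \<subseteq> M" using S(1) XM[OF xN(1)] XM[OF j(1)] j(3) by auto
    have "X x \<inter> X j = {}" by (rule bundlesD(4)[OF bd xN(1) j(1) j(2)[symmetric]])
    then show "(X j - {g}) \<inter> S = {}" using S(1) by auto
    show "j \<noteq> x" by (rule j(2))
    fix i assume i: "i \<in> N" "i \<noteq> j" "i \<noteq> x"
    have "X x \<inter> X i = {}" "X j \<inter> X i = {}"
      using bundlesD(4)[OF bd xN(1) i(1)] bundlesD(4)[OF bd j(1) i(1)] i by auto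
    then show "(X j - {g} \<union> S) \<inter> X i = {}" using S(1) j(3) by auto
  qed
  have ne: "X k - {gb} \<noteq> {}" "X l - {gc} \<noteq> {}" using k(3) l(3) posl by fastforce+
  \<comment> \<open>After losing \<open>gb\<close>, bundle \<open>k\<close> still meets the bound of
    type \<open>b\<close>. If \<open>S\<close> pleased \<open>a\<close>, the level would rise with
    unchanged types; if it pleased \<open>c\<close>, then \<open>x\<close> could join type
    \<open>c\<close>. If it pleases \<open>b\<close>, then \<open>x\<close> replaces
    \<open>h\<close> in type \<open>b\<close> and \<open>h\<close> joins type \<open>c\<close>,
    unless \<open>h\<close> is the bundle that lost the good.\<close>
  have stepB: "sum a S \<le> \<alpha>" "sum c S < \<gamma>" "\<beta> \<le> sum b S \<Longrightarrow> k = h"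
    if S: "S \<subseteq> insert gb (X x)" "S \<noteq> {}" "safe \<alpha> \<beta> \<gamma> S" for S
  proof -
    let ?Y = "X(k := X k - {gb}, x := S)"
    have bd': "bundles \<alpha> \<beta> \<gamma> ?Y" by (rule trim[OF kN(1,3) k(2) ne(1) S])
    have goodB: "\<beta> \<le> sum b (?Y i)" if "i \<in> B" for i using that k(3) good(1)[of i] xN by auto
    have goodC: "\<gamma> \<le> sum c (?Y i)" if "i \<in> C" for i using that good(2)[of i] xN kN by auto
    have goodA: "\<alpha> < sum a (?Y i)" if "i \<in> N - B - C" "i \<noteq> x" for i using others[OF that] that k(1) by auto
    show "sum a S \<le> \<alpha>"
    proof (rule ccontr)
      assume "\<not> sum a S \<le> \<alpha>"
      then have "\<alpha> < sum a (?Y i)" if "i \<in> N - B - C" for i using goodA[OF that] by (cases "i = x") auto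
      from config_reach_greater[OF bd' sub this goodB goodC card] top(2) qr show False by auto
    qed
    show "sum c S < \<gamma>"
    proof (rule ccontr)
      assume "\<not> sum c S < \<gamma>"
      then have cS: "\<gamma> \<le> sum c S" by simp
      have "\<exists>y>\<alpha>. reach q (Suc r) y"
      proof (rule config_reach_greater[OF bd', where B=B and C="insert x C"])
        show "B \<subseteq> N" "insert x C \<subseteq> N" "B \<inter> insert x C = {}" using sub xN by auto
        show "\<alpha> < sum a (?Y i)" if "i \<in> N - B - insert x C" for i using goodA[of i] that by auto
        show "\<beta> \<le> sum b (?Y i)" if "i \<in> B" for i by (rule goodB[OF that])
        show "\<gamma> \<le> sum c (?Y i)" if "i \<in> insert x C" for i using goodC[of i] that cS by (cases "i = x") auto
        show "card (insert x C) = Suc r" using fin xN card by simp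
      qed (rule card qr)+
      then show False using top(1) by blast
    qed
    show "k = h" if "\<beta> \<le> sum b S"
    proof (rule ccontr)
      assume "k \<noteq> h"
      have "\<exists>y>\<alpha>. reach q (Suc r) y"
      proof (rule config_reach_greater[OF bd', where B="insert x (B - {h})" and C="insert h C"])
        show "insert x (B - {h}) \<subseteq> N" "insert h C \<subseteq> N" "insert x (B - {h}) \<inter> insert h C = {}"
          using sub xN hN by auto
        show "\<alpha> < sum a (?Y i)" if "i \<in> N - insert x (B - {h}) - insert h C" for i
          using goodA[of i] that by auto
        show "\<beta> \<le> sum b (?Y i)" if "i \<in> insert x (B - {h})" for i
          using goodB[of i] that \<open>\<beta> \<le> sum b S\<close> by (cases "i = x") auto
        show "\<gamma> \<le> sum c (?Y i)" if "i \<in> insert h C" for i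
          using goodC[of i] that h(2) hN \<open>k \<noteq> h\<close> by (cases "i = h") auto
        show "card (insert x (B - {h})) = q" using card_exchange[OF fin(1) h(1) xN(2)] card by simp
        show "card (insert h C) = Suc r" using fin hN card by simp
      qed (rule qr)
      then show False using top(1) by blast
    qed
  qed
  \<comment> \<open>Now \<open>l\<close> loses \<open>gc\<close> and still meets the bound of type
    \<open>c\<close>. If \<open>S\<close> pleased \<open>a\<close> or \<open>b\<close>, then
    \<open>h\<close> would join type \<open>c\<close>, with \<open>x\<close> taking its place in
    type \<open>b\<close> in the second case. If \<open>S\<close> pleases \<open>c\<close>, then
    \<open>x\<close> joins type \<open>c\<close> and \<open>h\<close> stays in type
    \<open>b\<close>, which is safe to claim only if \<open>h\<close> is intact.\<close>
  have stepC: "sum a S \<le> \<alpha>" "sum b S < \<beta>" "\<gamma> \<le> sum c S \<Longrightarrow> l = h"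
    if S: "S \<subseteq> insert gc (X x)" "S \<noteq> {}" "safe \<alpha> \<beta> \<gamma> S" for S
  proof -
    let ?Y = "X(l := X l - {gc}, x := S)"
    have bd': "bundles \<alpha> \<beta> \<gamma> ?Y" by (rule trim[OF lN(1,2) l(2) ne(2) S])
    have goodB: "\<beta> \<le> sum b (?Y i)" if "i \<in> B - {h}" for i
      using that good(1)[of i] xN l(1) sub(3) by auto
    have goodC: "\<gamma> \<le> sum c (?Y i)" if "i \<in> insert h C" for i
      using that good(2)[of i] h(2) l(3) xN hN by auto
    have goodA: "\<alpha> < sum a (?Y i)" if "i \<in> N - B - C" "i \<noteq> x" for i using others[OF that] that l(1) h(1) by auto
    have cards: "card (insert x (B - {h})) = q" "card (insert h C) = Suc r" "card (B - {h}) = q - 1"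
      using card_exchange[OF fin(1) h(1) xN(2)] card fin hN h(1) by auto
    have subs: "B - {h} \<subseteq> N" "insert x (B - {h}) \<subseteq> N" "insert h C \<subseteq> N"
      "insert x (B - {h}) \<inter> insert h C = {}" "(B - {h}) \<inter> insert h C = {}"
      using sub xN hN by auto
    show "sum a S \<le> \<alpha>"
    proof (rule ccontr)
      assume "\<not> sum a S \<le> \<alpha>"
      then have "\<alpha> < sum a (?Y i)" if "i \<in> N - (B - {h}) - insert h C" for i
        using goodA[of i] that by (cases "i = x") auto
      then have "\<exists>y>\<alpha>. reach (q - 1) (Suc r) y"
        by (rule config_reach_greater[OF bd' subs(1,3,5) _ goodB goodC cards(3,2)]) (use qr in auto)
      then show False using top(3) by blast
    qed
    show "sum b S < \<beta>"
    proof (rule ccontr)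
      assume n: "\<not> sum b S < \<beta>"
      have "\<alpha> < sum a (?Y i)" if "i \<in> N - insert x (B - {h}) - insert h C" for i using goodA[of i] that by auto
      moreover have "\<beta> \<le> sum b (?Y i)" if "i \<in> insert x (B - {h})" for i
        using goodB[of i] that n by (cases "i = x") auto
      ultimately show False
        using config_reach_greater[OF bd' subs(2,3,4) _ _ goodC cards(1,2) qr] top(1) by blast
    qed
    show "l = h" if cS: "\<gamma> \<le> sum c S"
    proof (rule ccontr)
      assume lh: "l \<noteq> h"
      have "\<exists>y>\<alpha>. reach q (Suc r) y"
      proof (rule config_reach_greater[OF bd', where B=B and C="insert x C"])
        show "B \<subseteq> N" "insert x C \<subseteq> N" "B \<inter> insert x C = {}" using sub xN by auto
        show "\<alpha> < sum a (?Y i)" if "i \<in> N - B - insert x C" for i using goodA[of i] that by auto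
        show "\<beta> \<le> sum b (?Y i)" if "i \<in> B" for i using goodB[of i] that good(1)[OF h(1)] hN lh by (cases "i = h") auto
        show "\<gamma> \<le> sum c (?Y i)" if "i \<in> insert x C" for i using goodC[of i] that cS by (cases "i = x") auto
        show "card (insert x C) = Suc r" using fin xN card by simp
      qed (rule card qr)+
      then show False using top(1) by blast
    qed
  qed
  have gx: "gb \<notin> X x" "gc \<notin> X x"
    using bundlesD(4)[OF bd xN(1) kN(1)] bundlesD(4)[OF bd xN(1) lN(1)] kN lN k(2) l(2) by auto
  have gM: "gb \<in> M" "gc \<in> M" using k(2) l(2) XM kN lN by auto
  have claim: "\<exists>S\<subseteq>R. S \<noteq> {} \<and> safe \<alpha> \<beta> \<gamma> S \<and> (\<alpha> < sum a S \<or> \<beta> \<le> sum b S \<or> \<gamma> \<le> sum c S)"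
    if "R \<subseteq> M" "\<alpha> < sum a R \<or> \<beta> \<le> sum b R \<or> \<gamma> \<le> sum c R" for R
    using that posl by (intro safe_claim) auto
  have up: "\<alpha> < sum a (insert g (X x))" if "g \<in> M" "g \<notin> X x" for g
    using sum_insert_free[OF XM[OF xN(1)] that(2), of a] pos(1)[OF that(1)] ax by simp
  have insM: "insert gb (X x) \<subseteq> M" "insert gc (X x) \<subseteq> M" using gM XM[OF xN(1)] by auto
  obtain S where S: "S \<subseteq> insert gb (X x)" "S \<noteq> {}" "safe \<alpha> \<beta> \<gamma> S"
      "\<alpha> < sum a S \<or> \<beta> \<le> sum b S \<or> \<gamma> \<le> sum c S"
    using claim[OF insM(1)] up[OF gM(1) gx(1)] by blast
  have Sb: "\<beta> \<le> sum b S" "k = h" "sum c S < \<gamma>" using stepB[OF S(1-3)] S(4) by auto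
  show False
  proof (cases "l = h")
    case False
    obtain T where T: "T \<subseteq> insert gc (X x)" "T \<noteq> {}" "safe \<alpha> \<beta> \<gamma> T"
      "\<alpha> < sum a T \<or> \<beta> \<le> sum b T \<or> \<gamma> \<le> sum c T"
      using claim[OF insM(2)] up[OF gM(2) gx(2)] by blast
    from stepC[OF T(1-3)] T(4) False show False by auto
  next
    case True
    have SX: "S - {gb} \<subseteq> X x" and SM: "S \<subseteq> M" using S(1) insM by auto
    have gS: "gb \<in> S"
    proof (rule ccontr)
      assume "gb \<notin> S"
      then have "S \<subseteq> X x" using S(1) by auto
      from sum_mono_sub(2)[OF this XM[OF xN(1)]] Sb(1) L(2)[OF x(1)] show False by simp
    qed
    have gch: "gb \<in> X h" "gc \<in> X h" using k(2) l(2) Sb(2) True by auto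
    have "sum b (X h - {gc}) \<le> \<beta>" "sum c (X h - {gb}) \<le> \<gamma>"
      using bundlesD(3)[OF bd hN(1)] gch unfolding safe_def by auto
    \<comment> \<open>Removing \<open>gb\<close> leaves exactly \<open>\<beta>\<close> for
      \<open>b\<close>, while safety allows at most \<open>\<beta>\<close> after removing
      \<open>gc\<close>; symmetrically for \<open>c\<close>. So the two types rank \<open>gb\<close>
      and \<open>gc\<close> in opposite ways.\<close>
    then have cmp: "b gb \<le> b gc" "c gc \<le> c gb"
      using sum_Diff_one[OF XM[OF hN(1)] gch(1)] sum_Diff_one[OF XM[OF hN(1)] gch(2)] k(3) l(3) Sb(2) True
      by (smt (verit))+
    let ?R = "insert gc (S - {gb})"
    have R: "?R \<subseteq> M" "?R \<subseteq> insert gc (X x)" using SX gM SM by auto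
    have sums: "sum w ?R = w gc + sum w (S - {gb})" "sum w S = w gb + sum w (S - {gb})" for w :: "'g \<Rightarrow> real"
    proof -
      have "gc \<notin> S - {gb}" "S - {gb} \<subseteq> M" using SX gx(2) SM by auto
      then show "sum w ?R = w gc + sum w (S - {gb})" by (intro sum_insert_free)
      show "sum w S = w gb + sum w (S - {gb})" by (rule sum_Diff_one[OF SM gS])
    qed
    have "\<beta> \<le> sum b ?R" "sum c ?R < \<gamma>" using sums[of b] sums[of c] cmp Sb by linarith+
    then obtain T where T: "T \<subseteq> ?R" "T \<noteq> {}" "safe \<alpha> \<beta> \<gamma> T"
      "\<alpha> < sum a T \<or> \<beta> \<le> sum b T \<or> \<gamma> \<le> sum c T"
      using claim[OF R(1)] by blast
    have "T \<subseteq> insert gc (X x)" using T(1) R(2) by blast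
    from stepC[OF this T(2,3)] T(4) sum_mono_sub(3)[OF T(1) R(1)] \<open>sum c ?R < \<gamma>\<close>
    show False by auto
  qed
qed

text \<open>Bundles of type \<open>a\<close> are too poor to be \<open>k\<close> or
  \<open>l\<close>, so both belong to \<open>B\<close> or \<open>C\<close>. If \<open>k\<close> is
  in \<open>C\<close>, it trades types with \<open>h\<close>, which \<open>c\<close> accepts.
  Afterwards \<open>l\<close> itself takes the role of \<open>h\<close> if it has type
  \<open>b\<close>. This gives the positions required by \<open>exchange_aux\<close>.\<close>

lemma exchange_contradiction:
  assumes bd: "bundles \<alpha> \<beta> \<gamma> X" and sub: "B \<subseteq> N" "C \<subseteq> N" "B \<inter> C = {}"
    and L: "\<And>i. i \<in> N - B - C \<Longrightarrow> \<alpha> \<le> sum a (X i)" "\<And>i. i \<in> N - B - C \<Longrightarrow> sum b (X i) < \<beta>"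
      "\<And>i. i \<in> N - B - C \<Longrightarrow> sum c (X i) < \<gamma>"
    and good: "\<And>i. i \<in> B \<Longrightarrow> \<beta> \<le> sum b (X i)" "\<And>i. i \<in> C \<Longrightarrow> \<gamma> \<le> sum c (X i)"
    and h: "h \<in> B" "\<gamma> \<le> sum c (X h)"
    and k: "k \<in> N" "gb \<in> X k" "sum b (X k - {gb}) = \<beta>"
    and l: "l \<in> N" "gc \<in> X l" "sum c (X l - {gc}) = \<gamma>"
    and card: "card B = q" "card C = r" and qr: "q + Suc r < card N"
    and top: "\<And>y. \<alpha> < y \<Longrightarrow> \<not> reach q (Suc r) y" "\<And>y. \<alpha> < y \<Longrightarrow> \<not> reach q r y"
      "\<And>y. \<alpha> < y \<Longrightarrow> \<not> reach (q - 1) (Suc r) y"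
  shows False
proof -
  have fin: "finite B" "finite C" using sub finN by (blast intro: finite_subset)+
  have bk: "\<beta> \<le> sum b (X k)" using sum_mono_sub(2)[of "X k - {gb}" "X k"] bundlesD(1)[OF bd k(1)] k(3) by auto
  have cl: "\<gamma> \<le> sum c (X l)" using sum_mono_sub(3)[of "X l - {gc}" "X l"] bundlesD(1)[OF bd l(1)] l(3) by auto
  have kBC: "k \<in> B \<or> k \<in> C" using L(2)[of k] bk k(1) by force
  have lBC: "l \<in> B \<or> l \<in> C" using L(3)[of l] cl l(1) by force
  show False
  proof (cases "k \<in> B")
    case True
    have "\<exists>h'\<in>B. \<gamma> \<le> sum c (X h') \<and> l \<in> insert h' C" using lBC h cl by (cases "l \<in> B") auto
    then obtain h' where "h' \<in> B" "\<gamma> \<le> sum c (X h')" "l \<in> insert h' C" by blast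
    from exchange_aux[OF bd sub L good this(1,2) True k(2,3) this(3) l(2,3) card qr top] show False .
  next
    case False
    then have kC: "k \<in> C" using kBC by auto
    let ?B = "insert k (B - {h})" and ?C = "insert h (C - {k})"
    have "h \<notin> C" using h(1) sub(3) by auto
    then have card': "card ?B = q" "card ?C = r"
      using card_exchange[OF fin(1) h(1) False] card_exchange[OF fin(2) kC] card by auto
    have sub': "?B \<subseteq> N" "?C \<subseteq> N" "?B \<inter> ?C = {}" using sub h(1) kC by auto
    have eq: "N - ?B - ?C = N - B - C" using h(1) kC by auto
    have good': "\<beta> \<le> sum b (X i)" if "i \<in> ?B" for i using that good(1)[of i] bk by auto
    have good'': "\<gamma> \<le> sum c (X i)" if "i \<in> ?C" for i using that good(2)[of i] h(2) by auto
    have "\<exists>h'\<in>?B. \<gamma> \<le> sum c (X h') \<and> l \<in> insert h' ?C"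
      using lBC good(2)[OF kC] cl by (cases "l \<in> ?B") auto
    then obtain h' where "h' \<in> ?B" "\<gamma> \<le> sum c (X h')" "l \<in> insert h' ?C" by blast
    from exchange_aux[OF bd sub' L[folded eq] good' good'' this(1,2) insertI1 k(2,3) this(3) l(2,3) card' qr top]
    show False .
  qed
qed

section \<open>Trimming the bundles of type \<open>c\<close>\<close>

text \<open>Here the agents of type \<open>c\<close> are too rich: a newcomer of that type would envy only them. One
  good is taken from them and redistributed among the other two types, as for two types of agents;
  a set that pleases the newcomer on the way contradicts the maximality of \<open>\<alpha>\<close>.\<close>

lemma trim_step:
  assumes conf: "config \<alpha> \<beta>0 \<gamma> B C X0"
    and low: "\<And>i. i \<in> N - C \<Longrightarrow> sum c (X0 i) < \<gamma>"
    and k: "k \<in> C" "gc \<in> X0 k" "sum c (X0 k - {gc}) = \<gamma>"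
    and card: "card B = q" "card C = r" and qr: "q + Suc r < card N"
    and top: "\<And>y. \<alpha> < y \<Longrightarrow> \<not> reach q (Suc r) y" "\<And>y. \<alpha> < y \<Longrightarrow> \<not> reach q r y"
      "\<And>y q'. \<alpha> < y \<Longrightarrow> q = Suc q' \<Longrightarrow> \<not> reach q' (Suc r) y"
  shows "\<exists>\<beta> X. config \<alpha> \<beta> \<gamma> B C X \<and> \<Union> (X ` N) = M \<and> \<Union> (X ` C) \<subset> \<Union> (X0 ` C)"
proof -
  define Y where "Y = X0(k := X0 k - {gc})"
  have sub: "B \<subseteq> N" "C \<subseteq> N" "B \<inter> C = {}" and bd0: "bundles \<alpha> \<beta>0 \<gamma> X0"
    and good0: "\<And>i. i \<in> N - B - C \<Longrightarrow> \<alpha> \<le> sum a (X0 i)"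
      "\<And>i. i \<in> B \<Longrightarrow> \<beta>0 \<le> sum b (X0 i)" "\<And>i. i \<in> C \<Longrightarrow> \<gamma> \<le> sum c (X0 i)"
    using conf unfolding config_def by auto
  have fin: "finite B" "finite C" using sub finN by (blast intro: finite_subset)+
  have kN: "k \<in> N" "k \<notin> B" using k sub by auto
  have "card (B \<union> C) < card N" using card_Un_le[of B C] card qr by simp
  then have "\<not> N \<subseteq> B \<union> C" using fin card_mono[of "B \<union> C" N] by auto
  then obtain i0 where i0: "i0 \<in> N - B - C" by blast
  have nonneg: "0 \<le> \<alpha>" and gpos: "0 < \<gamma>"
    using bundles_nonneg(1)[OF bd0, of i0] low[of i0] i0
      sum_positive(3)[OF bundlesD(1)[OF bd0] bundlesD(2)[OF bd0], of i0] by auto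
  have ne: "X0 k - {gc} \<noteq> {}" using k(3) gpos by fastforce
  have bdY: "bundles \<alpha> \<beta>0 \<gamma> Y" unfolding Y_def
  proof (rule bundles_upd[OF bd0 _ ne])
    show "X0 k - {gc} \<subseteq> M" using bundlesD(1)[OF bd0 kN(1)] by auto
    show "safe \<alpha> \<beta>0 \<gamma> (X0 k - {gc})"
      by (rule safe_subset[OF bundlesD(3)[OF bd0 kN(1)] _ bundlesD(1)[OF bd0 kN(1)]]) auto
    show "(X0 k - {gc}) \<inter> X0 j = {}" if "j \<in> N" "j \<noteq> k" for j
      using bundlesD(4)[OF bd0 kN(1) that(1)] that(2) by auto
  qed
  have "config \<alpha> \<beta>0 \<gamma> B C Y"
    unfolding config_def using bdY sub good0 kN k(1,3) by (auto simp: Y_def)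
  \<comment> \<open>The bundles of type \<open>c\<close> are frozen in their trimmed form, with
    \<open>\<alpha>\<close> and \<open>\<gamma>\<close> fixed; only the level of \<open>b\<close> is
    maximised.\<close>
  define P where "P = (\<lambda>X. config \<alpha> (level M b B X) \<gamma> B C X \<and> (\<forall>i\<in>C. X i = Y i))"
  have lev: "config \<alpha> (level M b B X) \<gamma> B C X" if "config \<alpha> \<beta> \<gamma> B C X" for \<beta> X
    using config_levels_bc[OF that] that unfolding config_def bundles_def safe_def by simp
  have "P Y" unfolding P_def using lev[OF \<open>config \<alpha> \<beta>0 \<gamma> B C Y\<close>] by simp
  moreover have "finite (level M b B ` {X. P X})"
  proof (rule finite_subset)
    show "level M b B ` {X. P X} \<subseteq> insert (sum b M + 1) (sum b ` Pow M)"
    proof clarify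
      fix X assume "P X" "level M b B X \<notin> sum b ` Pow M"
      then have "X i \<subseteq> M" if "i \<in> B" for i
        using that sub(1) unfolding P_def config_def bundles_def by blast
      then have "level M b B X \<in> insert (sum b M + 1) (sum b ` Pow M)" by (rule level_in[OF fin(1)])
      then show "level M b B X = sum b M + 1" using \<open>level M b B X \<notin> sum b ` Pow M\<close> by blast
    qed
    show "finite (insert (sum b M + 1) (sum b ` Pow M))" using finM by simp
  qed
  ultimately obtain X where "P X" and Xmax: "\<And>X'. P X' \<Longrightarrow> level M b B X' \<le> level M b B X"
    by (rule ex_max_finite_image[where f="level M b B"]) blast
  define \<beta> where "\<beta> = level M b B X"
  have cfX: "config \<alpha> \<beta> \<gamma> B C X" and XY: "\<And>i. i \<in> C \<Longrightarrow> X i = Y i"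
    using \<open>P X\<close> unfolding P_def \<beta>_def by auto
  then have bd: "bundles \<alpha> \<beta> \<gamma> X"
    and good: "\<And>i. i \<in> N - B - C \<Longrightarrow> \<alpha> \<le> sum a (X i)"
      "\<And>i. i \<in> B \<Longrightarrow> \<beta> \<le> sum b (X i)" "\<And>i. i \<in> C \<Longrightarrow> \<gamma> \<le> sum c (X i)"
    unfolding config_def by auto
  have bnn: "0 \<le> \<beta>" using bundles_nonneg(2)[OF bd, of i0] i0 by auto
  have "\<Union> (X ` N) = M"
  proof (rule ccontr)
    assume "\<Union> (X ` N) \<noteq> M"
    then obtain g where g: "g \<in> M" "g \<notin> \<Union> (X ` N)" using bundlesD(1)[OF bd] by blast
    have free: "{g} \<inter> \<Union> (X ` N) = {}" using g by auto
    have claim: "\<exists>S\<subseteq>R. S \<noteq> {} \<and> safe \<alpha> \<beta> \<gamma> S \<and> (\<alpha> < sum a S \<or> \<beta> < sum b S \<or> \<gamma> \<le> sum c S)"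
      if "R \<subseteq> M" "\<alpha> < sum a R \<or> \<beta> < sum b R \<or> \<gamma> \<le> sum c R" for R
      using that nonneg gpos bnn by (intro safe_claim) auto
    have R: "insert g (X i) \<subseteq> M" "g \<notin> X i" "\<And>S j. S \<subseteq> insert g (X i) \<Longrightarrow> j \<in> N \<Longrightarrow> j \<noteq> i \<Longrightarrow> S \<inter> X j = {}"
      if "i \<in> N" for i
    proof -
      show "insert g (X i) \<subseteq> M" "g \<notin> X i" using bundlesD(1)[OF bd that] g that by auto
      show "S \<inter> X j = {}" if "S \<subseteq> insert g (X i)" "j \<in> N" "j \<noteq> i" for S j
        using disjoint_from_others[OF bd \<open>i \<in> N\<close> that(2) that(3)[symmetric] _ free] that(1) by auto
    qed
    have upd: "bundles \<alpha> \<beta> \<gamma> (X(i := S))" if "i \<in> N" "S \<subseteq> insert g (X i)" "S \<noteq> {}" "safe \<alpha> \<beta> \<gamma> S" for i S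
      by (rule bundles_upd[OF bd _ that(3,4)]) (use R[OF that(1)] that(2) in auto)
    obtain a1 where a1: "a1 \<in> N - B - C" "sum a (X a1) \<le> \<alpha>"
    proof (rule ccontr)
      assume "\<not> thesis"
      then have "\<And>i. i \<in> N - B - C \<Longrightarrow> \<alpha> < sum a (X i)" using that by force
      from config_reach_greater[OF bd sub this good(2,3) card] qr top(2) show False by auto
    qed
    then have eqa: "sum a (X a1) = \<alpha>" using good(1) by force
    have a1N: "a1 \<in> N" "a1 \<notin> B" "a1 \<notin> C" using a1 by auto
    have othA: "\<alpha> < sum a (X i)" if "i \<in> N - B - C" "i \<noteq> a1" for i
      using good(1)[of i] bundles_distinct(1)[OF bd a1N(1), of i] that eqa by force
    have "\<alpha> < sum a (insert g (X a1))"
      using sum_insert_free[of "X a1" g a] bundlesD(1)[OF bd a1N(1)] R(2)[OF a1N(1)] pos(1)[OF g(1)] eqa by simp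
    then obtain Sa where Sa: "Sa \<subseteq> insert g (X a1)" "Sa \<noteq> {}" "safe \<alpha> \<beta> \<gamma> Sa"
        "\<alpha> < sum a Sa \<or> \<beta> < sum b Sa \<or> \<gamma> \<le> sum c Sa"
      using claim[OF R(1)[OF a1N(1)]] by blast
    have SaM: "Sa \<subseteq> M" using Sa(1) R(1)[OF a1N(1)] by blast
    note bda = upd[OF a1N(1) Sa(1-3)]
    have aSa: "sum a Sa \<le> \<alpha>"
    proof (rule ccontr)
      assume n: "\<not> sum a Sa \<le> \<alpha>"
      have "\<exists>y>\<alpha>. reach q r y"
      proof (rule config_reach_greater[OF bda sub])
        show "\<alpha> < sum a ((X(a1 := Sa)) i)" if "i \<in> N - B - C" for i using othA[OF that] n by auto
        show "\<beta> \<le> sum b ((X(a1 := Sa)) i)" if "i \<in> B" for i using good(2)[OF that] that a1N by auto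
        show "\<gamma> \<le> sum c ((X(a1 := Sa)) i)" if "i \<in> C" for i using good(3)[OF that] that a1N by auto
      qed (use card qr in auto)
      then show False using top(2) by blast
    qed
    have cSa: "sum c Sa < \<gamma>"
    proof (rule ccontr)
      assume n: "\<not> sum c Sa < \<gamma>"
      have "\<exists>y>\<alpha>. reach q (Suc r) y"
      proof (rule config_reach_greater[OF bda, where B=B and C="insert a1 C"])
        show "B \<subseteq> N" "insert a1 C \<subseteq> N" "B \<inter> insert a1 C = {}" using sub a1N by auto
        show "\<alpha> < sum a ((X(a1 := Sa)) i)" if "i \<in> N - B - insert a1 C" for i using othA[of i] that by auto
        show "\<beta> \<le> sum b ((X(a1 := Sa)) i)" if "i \<in> B" for i using good(2)[OF that] that a1N by auto
        show "\<gamma> \<le> sum c ((X(a1 := Sa)) i)" if "i \<in> insert a1 C" for i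
          using good(3)[of i] that n by auto
        show "card (insert a1 C) = Suc r" using card fin a1N by simp
      qed (use card qr in auto)
      then show False using top(1) by blast
    qed
    have bSa: "\<beta> < sum b Sa" using Sa(4) aSa cSa by linarith
    \<comment> \<open>A set worth more than \<open>\<beta>\<close> shows that \<open>\<beta>\<close>
      is not the default value. So type \<open>b\<close> occurs and has a poorest agent.\<close>
    have "sum b Sa < sum b M + 1" using sum_mono_sub(2)[OF SaM order_refl] by simp
    then have bM: "\<beta> < sum b M + 1" using bSa by simp
    then obtain b1 where b1: "b1 \<in> B" "sum b (X b1) = \<beta>"
      using level_attained[OF fin(1)] unfolding \<beta>_def by blast
    have b1N: "b1 \<in> N" "b1 \<notin> C" "b1 \<noteq> a1" using b1 sub a1N by auto
    have othB: "\<beta> < sum b (X i)" if "i \<in> B" "i \<noteq> b1" for i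
      using good(2)[of i] bundles_distinct(2)[OF bd b1N(1), of i] that b1 sub by force
    have "\<beta> < sum b (insert g (X b1))"
      using sum_insert_free[of "X b1" g b] bundlesD(1)[OF bd b1N(1)] R(2)[OF b1N(1)] pos(2)[OF g(1)] b1 by simp
    then obtain Sb where Sb: "Sb \<subseteq> insert g (X b1)" "Sb \<noteq> {}" "safe \<alpha> \<beta> \<gamma> Sb"
        "\<alpha> < sum a Sb \<or> \<beta> < sum b Sb \<or> \<gamma> \<le> sum c Sb"
      using claim[OF R(1)[OF b1N(1)]] by blast
    have SbM: "Sb \<subseteq> M" using Sb(1) R(1)[OF b1N(1)] by blast
    note bdb = upd[OF b1N(1) Sb(1-3)]
    have bSb: "sum b Sb \<le> \<beta>"
    proof (rule ccontr)
      assume n: "\<not> sum b Sb \<le> \<beta>"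
      have "config \<alpha> \<beta> \<gamma> B C (X(b1 := Sb))"
        unfolding config_def using bdb sub good b1(1) b1N n by auto
      then have "P (X(b1 := Sb))" unfolding P_def using lev XY b1N by auto
      from Xmax[OF this] have "level M b B (X(b1 := Sb)) \<le> \<beta>" unfolding \<beta>_def .
      moreover have "\<beta> < level M b B (X(b1 := Sb))"
        using othB n by (intro level_greater[OF fin(1) bM]) auto
      ultimately show False by simp
    qed
    have sw: "insert a1 (B - {b1}) \<subseteq> N" "insert b1 C \<subseteq> N" "insert a1 (B - {b1}) \<inter> C = {}"
      "insert a1 (B - {b1}) \<inter> insert b1 C = {}" "B - {b1} \<subseteq> N" "(B - {b1}) \<inter> insert b1 C = {}"
      using sub a1N b1N by auto
    have cards: "card (insert a1 (B - {b1})) = q" "card (insert b1 C) = Suc r" "Suc (card (B - {b1})) = q"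
      using card_exchange[OF fin(1) b1(1) a1N(2)] card fin b1N b1(1) card_Suc_Diff1[OF fin(1) b1(1)] by auto
    \<comment> \<open>Three retypings of the bundles at \<open>a1\<close> and \<open>b1\<close>,
      each contradicting the maximality of \<open>\<alpha>\<close>: to \<open>b\<close> and
      \<open>a\<close>, to \<open>b\<close> and \<open>c\<close>, and to \<open>a\<close> and
      \<open>c\<close>. They suffice because every other bundle of type \<open>a\<close> is worth
      more than \<open>\<alpha>\<close>.\<close>
    have no_ab: False
      if Z: "bundles \<alpha> \<beta> \<gamma> Z" "\<And>i. i \<noteq> a1 \<Longrightarrow> i \<noteq> b1 \<Longrightarrow> Z i = X i"
        and z: "\<beta> \<le> sum b (Z a1)" "\<alpha> < sum a (Z b1)" for Z
    proof -
      have "\<exists>y>\<alpha>. reach q r y"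
      proof (rule config_reach_greater[OF Z(1) sw(1) sub(2) sw(3)])
        show "\<alpha> < sum a (Z i)" if "i \<in> N - insert a1 (B - {b1}) - C" for i
          using othA[of i] Z(2)[of i] z that by (cases "i = b1") auto
        show "\<beta> \<le> sum b (Z i)" if "i \<in> insert a1 (B - {b1})" for i
          using good(2)[of i] Z(2)[of i] z that by (cases "i = a1") auto
        show "\<gamma> \<le> sum c (Z i)" if "i \<in> C" for i
        proof -
          have "i \<noteq> a1" "i \<noteq> b1" using that a1N b1N by auto
          then show ?thesis using good(3)[OF that] Z(2)[of i] by simp
        qed
      qed (use cards card qr in auto)
      then show False using top(2) by blast
    qed
    have no_cb: False
      if Z: "bundles \<alpha> \<beta> \<gamma> Z" "\<And>i. i \<noteq> a1 \<Longrightarrow> i \<noteq> b1 \<Longrightarrow> Z i = X i"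
        and z: "\<beta> \<le> sum b (Z a1)" "\<gamma> \<le> sum c (Z b1)" for Z
    proof -
      have "\<exists>y>\<alpha>. reach q (Suc r) y"
      proof (rule config_reach_greater[OF Z(1) sw(1,2,4)])
        show "\<alpha> < sum a (Z i)" if "i \<in> N - insert a1 (B - {b1}) - insert b1 C" for i
          using othA[of i] Z(2)[of i] z that by auto
        show "\<beta> \<le> sum b (Z i)" if "i \<in> insert a1 (B - {b1})" for i
          using good(2)[of i] Z(2)[of i] z that by (cases "i = a1") auto
        show "\<gamma> \<le> sum c (Z i)" if "i \<in> insert b1 C" for i
        proof (cases "i = b1")
          case False
          then have "i \<in> C" "i \<noteq> a1" using that a1N by auto
          then show ?thesis using good(3)[of i] Z(2)[of i] False by simp
        qed (use z in simp)
      qed (use cards card qr in auto)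
      then show False using top(1) by blast
    qed
    have no_ac: False
      if Z: "bundles \<alpha> \<beta> \<gamma> Z" "\<And>i. i \<noteq> a1 \<Longrightarrow> i \<noteq> b1 \<Longrightarrow> Z i = X i"
        and z: "\<alpha> < sum a (Z a1)" "\<gamma> \<le> sum c (Z b1)" for Z
    proof -
      have "\<exists>y>\<alpha>. reach (card (B - {b1})) (Suc r) y"
      proof (rule config_reach_greater[OF Z(1) sw(5,2,6)])
        show "\<alpha> < sum a (Z i)" if "i \<in> N - (B - {b1}) - insert b1 C" for i
          using othA[of i] Z(2)[of i] z that by (cases "i = a1") auto
        show "\<beta> \<le> sum b (Z i)" if "i \<in> B - {b1}" for i
        proof -
          have "i \<noteq> a1" using that a1N by auto
          then show ?thesis using good(2)[of i] Z(2)[of i] that by simp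
        qed
        show "\<gamma> \<le> sum c (Z i)" if "i \<in> insert b1 C" for i
        proof (cases "i = b1")
          case False
          then have "i \<in> C" "i \<noteq> a1" using that a1N by auto
          then show ?thesis using good(3)[of i] Z(2)[of i] False by simp
        qed (use z in simp)
      qed (use cards qr in auto)
      then show False using top(3)[OF _ cards(3)[symmetric]] by blast
    qed
    have XM: "X a1 \<subseteq> M" "X b1 \<subseteq> M" using bundlesD(1)[OF bd] a1N b1N by auto
    have dis: "X a1 \<inter> X b1 = {}" using bundlesD(4)[OF bd a1N(1) b1N(1)] b1N by auto
    have gX: "g \<notin> X a1" "g \<notin> X b1" using R(2) a1N b1N by auto
    have ba1: "sum b (X a1) \<le> \<beta>"
    proof (rule ccontr)
      assume "\<not> sum b (X a1) \<le> \<beta>"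
      then show False using no_ab[OF bdb] no_cb[OF bdb] Sb(4) bSb b1N(3) by fastforce
    qed
    have gSa: "g \<in> Sa"
    proof (rule ccontr)
      assume "g \<notin> Sa"
      then have "Sa \<subseteq> X a1" using Sa(1) by auto
      from sum_mono_sub(2)[OF this XM(1)] bSa ba1 show False by simp
    qed
    have subs: "Sa - {g} \<subseteq> X a1" "Sb - {g} \<subseteq> X b1" using Sa(1) Sb(1) by auto
    have sums: "sum w (X a1) = sum w (Sa - {g}) + sum w (X a1 - (Sa - {g}))"
        "sum w (X b1) = sum w (Sb - {g}) + sum w (X b1 - (Sb - {g}))"
        "sum w Sa = w g + sum w (Sa - {g})"
        "sum w ((Sa - {g}) \<union> (X b1 - (Sb - {g}))) = sum w (Sa - {g}) + sum w (X b1 - (Sb - {g}))"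
        "sum w ((Sb - {g}) \<union> (X a1 - (Sa - {g}))) = sum w (Sb - {g}) + sum w (X a1 - (Sa - {g}))"
      for w :: "'g \<Rightarrow> real"
    proof -
      show "sum w (X a1) = sum w (Sa - {g}) + sum w (X a1 - (Sa - {g}))" by (rule sum_split[OF XM(1) subs(1)])
      show "sum w (X b1) = sum w (Sb - {g}) + sum w (X b1 - (Sb - {g}))" by (rule sum_split[OF XM(2) subs(2)])
      show "sum w Sa = w g + sum w (Sa - {g})" by (rule sum_Diff_one[OF SaM gSa])
      show "sum w ((Sa - {g}) \<union> (X b1 - (Sb - {g}))) = sum w (Sa - {g}) + sum w (X b1 - (Sb - {g}))"
        by (rule sum_Un_split) (use subs XM dis in auto)
      show "sum w ((Sb - {g}) \<union> (X a1 - (Sa - {g}))) = sum w (Sb - {g}) + sum w (X a1 - (Sa - {g}))"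
        by (rule sum_Un_split) (use subs XM dis in auto)
    qed
    have upd2: "bundles \<alpha> \<beta> \<gamma> (X(a1 := S, b1 := T))"
      if S: "S \<noteq> {}" "safe \<alpha> \<beta> \<gamma> S" and T: "T \<noteq> {}" "safe \<alpha> \<beta> \<gamma> T"
        and ST: "S \<inter> T = {}" "S \<union> T \<subseteq> insert g (X a1 \<union> X b1)" for S T
    proof (rule bundles_upd2[OF bd _ S _ T ST(1)])
      show "S \<subseteq> M" "T \<subseteq> M" using ST(2) XM g(1) by auto
      show "a1 \<noteq> b1" using b1N by auto
      fix i assume i: "i \<in> N" "i \<noteq> a1" "i \<noteq> b1"
      have "X a1 \<inter> X i = {}" "X b1 \<inter> X i = {}" "g \<notin> X i"
        using bundlesD(4)[OF bd a1N(1) i(1)] bundlesD(4)[OF bd b1N(1) i(1)] i g by auto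
      then show "(S \<union> T) \<inter> X i = {}" using ST(2) by blast
    qed
    show False
    proof (cases "\<gamma> \<le> sum c Sb")
      case True
      have cb1: "sum c (X b1) < \<gamma>"
      proof (rule ccontr)
        assume "\<not> sum c (X b1) < \<gamma>"
        then show False using no_cb[OF bda] bSa b1N(3) by auto
      qed
      have gSb: "g \<in> Sb"
      proof (rule ccontr)
        assume "g \<notin> Sb"
        then have "Sb \<subseteq> X b1" using Sb(1) by auto
        from sum_mono_sub(3)[OF this XM(2)] True cb1 show False by simp
      qed
      \<comment> \<open>In \<open>Sa\<close> the good \<open>g\<close> is replaced by what
        \<open>Sb\<close> leaves of \<open>X b1\<close>. To \<open>b\<close> this is worth at least
        \<open>g\<close>, since \<open>Sb\<close> is worth at most \<open>X b1\<close>; to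
        \<open>c\<close> it is worth less than \<open>g\<close>, since \<open>Sb\<close> pleases
        \<open>c\<close> and \<open>X b1\<close> does not.\<close>
      let ?R = "(Sa - {g}) \<union> (X b1 - (Sb - {g}))"
      have sumb: "sum w Sb = w g + sum w (Sb - {g})" for w :: "'g \<Rightarrow> real" by (rule sum_Diff_one[OF SbM gSb])
      have RM: "?R \<subseteq> M" using subs XM by auto
      have "\<beta> < sum b ?R" using sums[of b] sumb[of b] bSa bSb b1(2) by linarith
      then obtain S where S: "S \<subseteq> ?R" "S \<noteq> {}" "safe \<alpha> \<beta> \<gamma> S"
          "\<alpha> < sum a S \<or> \<beta> < sum b S \<or> \<gamma> \<le> sum c S"
        using claim[OF RM] by blast
      have "sum c ?R < \<gamma>" using sums[of c] sumb[of c] cSa True cb1 by linarith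
      then have nc: "\<not> \<gamma> \<le> sum c S" using sum_mono_sub(3)[OF S(1) RM] by simp
      have "S \<inter> Sb = {}" "S \<union> Sb \<subseteq> insert g (X a1 \<union> X b1)" using S(1) subs Sb(1) gX dis by blast+
      from upd2[OF S(2,3) Sb(2,3) this] have bd': "bundles \<alpha> \<beta> \<gamma> (X(a1 := S, b1 := Sb))" .
      show False using no_cb[OF bd'] no_ac[OF bd'] S(4) nc True b1N(3) by fastforce
    next
      case False
      then have aSb: "\<alpha> < sum a Sb" using Sb(4) bSb by linarith
      have ab1: "sum a (X b1) \<le> \<alpha>"
      proof (rule ccontr)
        assume "\<not> sum a (X b1) \<le> \<alpha>"
        then show False using no_ab[OF bda] bSa b1N(3) by auto
      qed
      have gSb: "g \<in> Sb"
      proof (rule ccontr)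
        assume "g \<notin> Sb"
        then have "Sb \<subseteq> X b1" using Sb(1) by auto
        from sum_mono_sub(1)[OF this XM(2)] aSb ab1 show False by simp
      qed
      \<comment> \<open>The same replacement with the roles reversed: in \<open>Sb\<close> the good
        \<open>g\<close> gives way to what \<open>Sa\<close> leaves of \<open>X a1\<close>, worth at
        least \<open>g\<close> to \<open>a\<close> and less than \<open>g\<close> to
        \<open>b\<close>.\<close>
      let ?R = "(Sb - {g}) \<union> (X a1 - (Sa - {g}))"
      have sumb: "sum w Sb = w g + sum w (Sb - {g})" for w :: "'g \<Rightarrow> real" by (rule sum_Diff_one[OF SbM gSb])
      have RM: "?R \<subseteq> M" using subs XM by auto
      have "\<alpha> < sum a ?R" using sums[of a] sumb[of a] aSa aSb eqa by linarith
      then obtain S where S: "S \<subseteq> ?R" "S \<noteq> {}" "safe \<alpha> \<beta> \<gamma> S"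
          "\<alpha> < sum a S \<or> \<beta> < sum b S \<or> \<gamma> \<le> sum c S"
        using claim[OF RM] by blast
      have "sum b ?R < \<beta>" using sums[of b] sumb[of b] bSa bSb ba1 by linarith
      then have nb: "\<not> \<beta> < sum b S" using sum_mono_sub(2)[OF S(1) RM] by simp
      have "Sa \<inter> S = {}" "Sa \<union> S \<subseteq> insert g (X a1 \<union> X b1)" using S(1) subs Sa(1) gX dis by blast+
      from upd2[OF Sa(2,3) S(2,3) this] have bd': "bundles \<alpha> \<beta> \<gamma> (X(a1 := Sa, b1 := S))" .
      show False using no_cb[OF bd'] no_ab[OF bd'] S(4) nb bSa b1N(3) by fastforce
    qed
  qed
  moreover have "\<Union> (X ` C) \<subset> \<Union> (X0 ` C)"
  proof
    show "\<Union> (X ` C) \<subseteq> \<Union> (X0 ` C)" using XY unfolding Y_def by (auto split: if_splits)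
    have "gc \<notin> X i" if "i \<in> C" for i
      using XY[OF that] k(2) bundlesD(4)[OF bd0 kN(1), of i] that sub unfolding Y_def by (auto split: if_splits)
    then show "\<Union> (X ` C) \<noteq> \<Union> (X0 ` C)" using k by blast
  qed
  ultimately show ?thesis using cfX by (intro exI[of _ \<beta>] exI[of _ X] conjI)
qed

section \<open>Adding the missing agent of type \<open>c\<close>\<close>

text \<open>The attained maximum is the smallest bound that keeps the family safe for the valuation
  \<open>w\<close>, and the pair \<open>k\<close>, \<open>g\<close> witnesses it.\<close>

lemma threshold:
  fixes w :: "'g \<Rightarrow> real"
  assumes "bundles \<alpha> \<beta> \<gamma> X" "N \<noteq> {}"
  obtains k g where "k \<in> N" "g \<in> X k"
    "\<And>i h. i \<in> N \<Longrightarrow> h \<in> X i \<Longrightarrow> sum w (X i - {h}) \<le> sum w (X k - {g})"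
proof -
  let ?F = "\<Union>i\<in>N. (\<lambda>g. sum w (X i - {g})) ` X i"
  have "finite (X i)" if "i \<in> N" for i using bundlesD(1)[OF assms(1) that] finM finite_subset by auto
  then have fin: "finite ?F" using finN by auto
  moreover have "?F \<noteq> {}" using assms(2) bundlesD(2)[OF assms(1)] by auto
  ultimately have "Max ?F \<in> ?F" by (rule Max_in)
  then obtain k g where kg: "k \<in> N" "g \<in> X k" "Max ?F = sum w (X k - {g})" by auto
  have "sum w (X i - {h}) \<le> Max ?F" if "i \<in> N" "h \<in> X i" for i h
    using that by (intro Max_ge[OF fin]) auto
  then show thesis using that kg by simp
qed

text \<open>Among the complete configurations with one agent of type \<open>c\<close> too few, one
  is chosen whose bundles of type \<open>c\<close> contain the fewest goods in total. By
  \<open>trim_step\<close>, this minimality provides a bundle outside type \<open>c\<close> that a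
  newcomer of type \<open>c\<close> would accept.\<close>

lemma full_by_exchange:
  assumes full: "reach_full q r \<alpha>" and qr: "q + Suc r < card N"
    and top: "\<And>y. \<alpha> < y \<Longrightarrow> \<not> reach q (Suc r) y" "\<And>y. \<alpha> < y \<Longrightarrow> \<not> reach q r y"
      "\<And>y q'. \<alpha> < y \<Longrightarrow> q = Suc q' \<Longrightarrow> \<not> reach q' (Suc r) y"
  shows "reach_full q (Suc r) \<alpha>"
proof -
  define P where "P = (\<lambda>(\<beta>, \<gamma>, B, C, X). config \<alpha> \<beta> \<gamma> B C X \<and> card B = q \<and> card C = r \<and> \<Union> (X ` N) = M)"
  define f where "f = (\<lambda>(\<beta> :: real, \<gamma> :: real, B :: 'i set, C :: 'i set, X :: 'i \<Rightarrow> 'g set). card (\<Union> (X ` C)))"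
  obtain s where "P s" using full unfolding reach_full_def P_def by auto
  then obtain t where t: "P t" and tmin: "\<And>u. P u \<Longrightarrow> f t \<le> f u"
    using ex_has_least_nat[of P s f] by blast
  obtain \<beta> \<gamma> B C X where teq: "t = (\<beta>, \<gamma>, B, C, X)" by (metis surj_pair)
  have cf: "config \<alpha> \<beta> \<gamma> B C X" and card: "card B = q" "card C = r" and full: "\<Union> (X ` N) = M"
    using t unfolding P_def teq by auto
  have bd: "bundles \<alpha> \<beta> \<gamma> X" and sub: "B \<subseteq> N" "C \<subseteq> N" "B \<inter> C = {}"
    and good: "\<And>i. i \<in> N - B - C \<Longrightarrow> \<alpha> \<le> sum a (X i)"
      "\<And>i. i \<in> B \<Longrightarrow> \<beta> \<le> sum b (X i)" "\<And>i. i \<in> C \<Longrightarrow> \<gamma> \<le> sum c (X i)"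
    using cf unfolding config_def by auto
  have fin: "finite B" "finite C" using sub finN by (blast intro: finite_subset)+
  have N0: "N \<noteq> {}" using qr by auto
  obtain k gb where k: "k \<in> N" "gb \<in> X k"
    "\<And>i h. i \<in> N \<Longrightarrow> h \<in> X i \<Longrightarrow> sum b (X i - {h}) \<le> sum b (X k - {gb})"
    by (rule threshold[OF bd N0, where w=b]) blast
  obtain l gc where l: "l \<in> N" "gc \<in> X l"
    "\<And>i h. i \<in> N \<Longrightarrow> h \<in> X i \<Longrightarrow> sum c (X i - {h}) \<le> sum c (X l - {gc})"
    by (rule threshold[OF bd N0, where w=c]) blast
  \<comment> \<open>Lowering the bounds as far as safety permits makes a bundle easier to accept for
    \<open>b\<close> and \<open>c\<close>. It also supplies goods whose removal leaves exactly the
    bound.\<close>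
  define \<beta>' where "\<beta>' = sum b (X k - {gb})"
  define \<gamma>' where "\<gamma>' = sum c (X l - {gc})"
  have le: "\<beta>' \<le> \<beta>" "\<gamma>' \<le> \<gamma>"
    using bundlesD(3)[OF bd k(1)] bundlesD(3)[OF bd l(1)] k(2) l(2)
    unfolding safe_def \<beta>'_def \<gamma>'_def by auto
  have "safe \<alpha> \<beta>' \<gamma>' (X i)" if "i \<in> N" for i
    using bundlesD(3)[OF bd that] k(3)[OF that] l(3)[OF that] unfolding safe_def \<beta>'_def \<gamma>'_def by blast
  then have bd': "bundles \<alpha> \<beta>' \<gamma>' X" using bd unfolding bundles_def by blast
  have bd'': "bundles \<alpha> \<beta> \<gamma>' X"
    using bd' safe_mono[OF _ order_refl le(1) order_refl] unfolding bundles_def by blast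
  have goodB: "\<beta>' \<le> sum b (X i)" if "i \<in> B" for i using good(2)[OF that] le(1) by simp
  have goodC: "\<gamma>' \<le> sum c (X i)" if "i \<in> C" for i using good(3)[OF that] le(2) by simp
  have fullI: "reach_full q (Suc r) \<alpha>" if "config \<alpha> \<beta>1 \<gamma>1 B1 C1 X" "card B1 = q" "card C1 = Suc r"
    for \<beta>1 \<gamma>1 B1 C1
    unfolding reach_full_def
    using that full by (intro exI[of _ \<beta>1] exI[of _ \<gamma>1] exI[of _ B1] exI[of _ C1] exI[of _ X] conjI)
  show ?thesis
  proof (cases "\<forall>i\<in>N - C. sum c (X i) < \<gamma>'")
    case True
    have "\<gamma>' \<le> sum c (X l)"
      using sum_mono_sub(3)[of "X l - {gc}" "X l"] bundlesD(1)[OF bd l(1)] unfolding \<gamma>'_def by auto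
    then have lC: "l \<in> C" using True l(1) by force
    have conf: "config \<alpha> \<beta> \<gamma>' B C X" by (rule configI[OF bd'' sub good(1,2) goodC])
    have low: "sum c (X i) < \<gamma>'" if "i \<in> N - C" for i using True that by blast
    have "\<exists>\<beta>1 Y. config \<alpha> \<beta>1 \<gamma>' B C Y \<and> \<Union> (Y ` N) = M \<and> \<Union> (Y ` C) \<subset> \<Union> (X ` C)"
      by (rule trim_step[OF conf low lC l(2) \<gamma>'_def[symmetric] card qr top])
    then obtain \<beta>1 Y where Y: "config \<alpha> \<beta>1 \<gamma>' B C Y" "\<Union> (Y ` N) = M" "\<Union> (Y ` C) \<subset> \<Union> (X ` C)"
      by (elim exE conjE)
    then have "P (\<beta>1, \<gamma>', B, C, Y)" unfolding P_def using card by simp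
    from tmin[OF this] have "card (\<Union> (X ` C)) \<le> card (\<Union> (Y ` C))" unfolding f_def teq by simp
    moreover have "card (\<Union> (Y ` C)) < card (\<Union> (X ` C))"
    proof (rule psubset_card_mono[OF finite_subset[OF _ finM] Y(3)])
      show "\<Union> (X ` C) \<subseteq> M" using full sub by blast
    qed
    ultimately show ?thesis by simp
  next
    case False
    then obtain h where h: "h \<in> N - C" "\<gamma>' \<le> sum c (X h)" by force
    show ?thesis
    proof (cases "\<exists>i\<in>N - B - C. \<gamma>' \<le> sum c (X i)")
      case True
      then obtain i where i: "i \<in> N - B - C" "\<gamma>' \<le> sum c (X i)" by blast
      have "config \<alpha> \<beta> \<gamma>' B (insert i C) X"
      proof (rule configI[OF bd''])
        show "\<alpha> \<le> sum a (X j)" if "j \<in> N - B - insert i C" for j using good(1)[of j] that by simp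
        show "\<beta> \<le> sum b (X j)" if "j \<in> B" for j by (rule good(2)[OF that])
        show "\<gamma>' \<le> sum c (X j)" if "j \<in> insert i C" for j using goodC[of j] i that by auto
      qed (use sub i in auto)
      then show ?thesis using card i fin by (intro fullI) auto
    next
      case noc: False
      then have hB: "h \<in> B" using h by blast
      then have hC: "h \<notin> C" using sub by blast
      show ?thesis
      proof (cases "\<exists>i\<in>N - B - C. \<beta>' \<le> sum b (X i)")
        case True
        then obtain i where i: "i \<in> N - B - C" "\<beta>' \<le> sum b (X i)" by blast
        have subs: "insert i (B - {h}) \<subseteq> N" "insert h C \<subseteq> N" "insert i (B - {h}) \<inter> insert h C = {}"
          using sub i hB hC by auto
        have "config \<alpha> \<beta>' \<gamma>' (insert i (B - {h})) (insert h C) X"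
        proof (rule configI[OF bd' subs])
          show "\<alpha> \<le> sum a (X j)" if "j \<in> N - insert i (B - {h}) - insert h C" for j
            using good(1)[of j] that by auto
          show "\<beta>' \<le> sum b (X j)" if "j \<in> insert i (B - {h})" for j using goodB[of j] i that by auto
          show "\<gamma>' \<le> sum c (X j)" if "j \<in> insert h C" for j using goodC[of j] h that by auto
        qed
        moreover have "card (insert i (B - {h})) = q" "card (insert h C) = Suc r"
          using card_exchange[OF fin(1) hB, of i] i card fin hC by auto
        ultimately show ?thesis by (rule fullI)
      next
        \<comment> \<open>The newcomer can only take a bundle of type \<open>b\<close>, and no
          bundle of type \<open>a\<close> can replace it. Retyping alone is thus impossible, and a
          good has to move.\<close>
        case nob: False
        obtain q' where q': "q = Suc q'" using card hB fin by (metis card_gt_0_iff empty_iff gr0_implies_Suc)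
        have "False"
        proof (rule exchange_contradiction[OF bd' sub good(1) _ _ goodB goodC hB h(2) k(1,2) \<beta>'_def[symmetric]
              l(1,2) \<gamma>'_def[symmetric] card qr top(1,2)])
          show "sum b (X i) < \<beta>'" if "i \<in> N - B - C" for i using nob that by force
          show "sum c (X i) < \<gamma>'" if "i \<in> N - B - C" for i using noc that by force
          show "\<not> reach (q - 1) (Suc r) y" if "\<alpha> < y" for y using top(3)[OF that q'] q' by simp
        qed
        then show ?thesis ..
      qed
    qed
  qed
qed

section \<open>Symmetry of \<open>b\<close> and \<open>c\<close>, and the induction\<close>

text \<open>Interchanging the last two valuations lets \<open>full_by_exchange\<close> serve also
  when the missing agent has type \<open>b\<close>.\<close>

lemma swap: "three_valuations M N a c b"
  using finM finN pos inj by unfold_locales auto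

lemma swap_config: "three_valuations.config M N a c b \<alpha> \<gamma> \<beta> C B X \<longleftrightarrow> config \<alpha> \<beta> \<gamma> B C X"
proof -
  interpret sw: three_valuations M N a c b by (rule swap)
  have "sw.safe \<alpha> \<gamma> \<beta> S \<longleftrightarrow> safe \<alpha> \<beta> \<gamma> S" for S unfolding sw.safe_def safe_def by blast
  then have "sw.bundles \<alpha> \<gamma> \<beta> X \<longleftrightarrow> bundles \<alpha> \<beta> \<gamma> X" unfolding sw.bundles_def bundles_def by simp
  moreover have "N - C - B = N - B - C" by blast
  ultimately show ?thesis unfolding sw.config_def config_def by auto
qed

lemma swap_reach: "three_valuations.reach M N a c b r q x \<longleftrightarrow> reach q r x"
proof -
  interpret sw: three_valuations M N a c b by (rule swap)
  show ?thesis unfolding sw.reach_def reach_def swap_config by blast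
qed

lemma swap_reach_full: "three_valuations.reach_full M N a c b r q x \<longleftrightarrow> reach_full q r x"
proof -
  interpret sw: three_valuations M N a c b by (rule swap)
  show ?thesis unfolding sw.reach_full_def reach_full_def swap_config by blast
qed

lemma reach_full_imp_reach: "reach_full q r x \<Longrightarrow> reach q r x"
  unfolding reach_full_def reach_def by blast

text \<open>Replacing \<open>x\<close> by the actual level moves it into a finite set of values, so
  that a largest reachable number exists.\<close>

lemma reach_tight:
  assumes "reach q r x" "q + r < card N"
  obtains y where "y \<in> insert (sum a M + 1) (sum a ` Pow M)" "x \<le> y" "reach q r y"
proof -
  obtain \<beta> \<gamma> B C X where cf: "config x \<beta> \<gamma> B C X" and card: "card B = q" "card C = r"
    using assms(1) unfolding reach_def by blast
  have bd: "bundles x \<beta> \<gamma> X" and sub: "B \<subseteq> N" "C \<subseteq> N"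
    and good: "\<And>i. i \<in> N - B - C \<Longrightarrow> x \<le> sum a (X i)" using cf unfolding config_def by auto
  have fin: "finite B" "finite C" "finite (N - B - C)" using sub finN by (blast intro: finite_subset)+
  have "card (B \<union> C) < card N" using card_Un_le[of B C] card assms(2) by simp
  then have "\<not> N \<subseteq> B \<union> C" using fin card_mono[of "B \<union> C" N] by auto
  then obtain i where i: "i \<in> N - B - C" by blast
  have "x \<le> sum a M + 1"
    using good[OF i] sum_mono_sub(1)[OF bundlesD(1)[OF bd] order_refl, of i] i by auto
  then have "x \<le> level M a (N - B - C) X" using good by (intro level_ge[OF fin(3)])
  moreover have "reach q r (level M a (N - B - C) X)"
    using config_levels[OF cf] card unfolding reach_def by blast
  moreover have "level M a (N - B - C) X \<in> insert (sum a M + 1) (sum a ` Pow M)"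
    by (rule level_in[OF fin(3)]) (use bundlesD(1)[OF bd] in auto)
  ultimately show thesis using that by blast
qed

text \<open>Strong induction on \<open>q + r\<close>: turning an agent of type \<open>b\<close> or
  \<open>c\<close> into one of type \<open>a\<close> lowers this number. Maximising over these
  neighbouring numbers together with the given ones provides all the maximality assumptions of the
  two completion lemmas.\<close>

lemma full_from_partial:
  "reach q r x \<Longrightarrow> q + r < card N \<Longrightarrow> \<exists>y\<ge>x. reach_full q r y"
proof (induction "q + r" arbitrary: q r x rule: less_induct)
  case less
  define V where "V = insert (sum a M + 1) (sum a ` Pow M)"
  define E where "E y \<longleftrightarrow> reach q r y \<or> (\<exists>r'. r = Suc r' \<and> reach q r' y) \<or> (\<exists>q'. q = Suc q' \<and> reach q' r y)" for y
  have tight: "\<exists>y'\<in>V. y \<le> y' \<and> E y'" if "E y" for y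
    using that less.prems(2) unfolding E_def V_def
    by (elim disjE exE conjE) (erule reach_tight, simp, blast)+
  have finV: "finite {y \<in> V. E y}" using finM unfolding V_def by simp
  have "E x" using less.prems(1) unfolding E_def by blast
  then obtain x' where x': "x' \<in> {y \<in> V. E y}" "x \<le> x'" using tight by blast
  define \<alpha> where "\<alpha> = Max {y \<in> V. E y}"
  have \<alpha>: "\<alpha> \<in> {y \<in> V. E y}" unfolding \<alpha>_def using Max_in[OF finV] x' by blast
  have "x \<le> \<alpha>" using Max_ge[OF finV x'(1)] x'(2) unfolding \<alpha>_def by simp
  have top: "\<not> E y" if "\<alpha> < y" for y
  proof
    assume "E y"
    then obtain y' where "y' \<in> {y \<in> V. E y}" "y \<le> y'" using tight by blast
    then show False using Max_ge[OF finV, of y'] that unfolding \<alpha>_def by simp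
  qed
  \<comment> \<open>The induction hypothesis only promises a level of at least
    \<open>\<alpha>\<close>. As the neighbouring numbers are counted in \<open>E\<close>, maximality
    forces equality.\<close>
  have IH: "reach_full q' r' \<alpha>" if lt: "q' + r' < q + r" and re: "reach q' r' \<alpha>" and "\<And>y. reach q' r' y \<Longrightarrow> E y" for q' r'
  proof -
    obtain y where y: "\<alpha> \<le> y" "reach_full q' r' y" using less.hyps[OF lt re] lt less.prems(2) by auto
    then have "\<not> \<alpha> < y" using top that(3) reach_full_imp_reach by blast
    then show ?thesis using y by simp
  qed
  have "reach_full q r \<alpha>"
  proof (cases "\<exists>r'. r = Suc r' \<and> reach q r' \<alpha>")
    case True
    then obtain r' where r': "r = Suc r'" "reach q r' \<alpha>" by blast
    have "reach_full q r' \<alpha>" by (rule IH) (use r' in \<open>auto simp: E_def\<close>)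
    from full_by_exchange[OF this] show ?thesis
      using less.prems(2) top unfolding r'(1) E_def by blast
  next
    case noc: False
    show ?thesis
    proof (cases "\<exists>q'. q = Suc q' \<and> reach q' r \<alpha>")
      case True
      then obtain q' where q': "q = Suc q'" "reach q' r \<alpha>" by blast
      interpret sw: three_valuations M N a c b by (rule swap)
      have "reach_full q' r \<alpha>" by (rule IH) (use q' in \<open>auto simp: E_def\<close>)
      then have "sw.reach_full r q' \<alpha>" by (simp add: swap_reach_full)
      then have "sw.reach_full r (Suc q') \<alpha>"
      proof (rule sw.full_by_exchange)
        show "r + Suc q' < card N" using less.prems(2) q' by simp
        show "\<not> sw.reach r (Suc q') y" "\<not> sw.reach r q' y" if "\<alpha> < y" for y
          using top[OF that] q' unfolding E_def swap_reach by blast+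
        show "\<not> sw.reach r' (Suc q') y" if "\<alpha> < y" "r = Suc r'" for y r'
          using top[OF that(1)] that(2) q' unfolding E_def swap_reach by blast
      qed
      then show ?thesis by (simp add: swap_reach_full q')
    next
      case nob: False
      show ?thesis
      proof (rule full_if_top_only)
        show "\<not> reach q r y" if "\<alpha> < y" for y using top[OF that] unfolding E_def by blast
        show "reach q r \<alpha>" using \<alpha> noc nob unfolding E_def by blast
      qed (use less.prems(2) noc nob in blast)+
    qed
  qed
  then show ?case using \<open>x \<le> \<alpha>\<close> by blast
qed

text \<open>A bundle of one good becomes empty when that good is removed, so all bounds can be zero.
  This starts the construction when there are at least as many goods as agents.\<close>

lemma reach_singletons:
  assumes "card N \<le> card M" "q + r \<le> card N"
  shows "reach q r 0"
proof -
  obtain f where f: "f ` N \<subseteq> M" "inj_on f N" using card_le_inj[OF finN finM assms(1)] by blast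
  obtain B where B: "B \<subseteq> N" "card B = q" using obtain_subset_with_card_n[of q N] assms(2) by auto
  have "r \<le> card (N - B)" using B assms(2) card_Diff_subset[OF finite_subset[OF B(1) finN] B(1)] by simp
  then obtain C where C: "C \<subseteq> N - B" "card C = r" using obtain_subset_with_card_n by blast
  have fM: "f i \<in> M" if "i \<in> N" for i using f(1) that by blast
  have "bundles 0 0 0 (\<lambda>i. {f i})"
    unfolding bundles_def safe_def disjoint_family_on_def using fM inj_onD[OF f(2)] by fastforce
  moreover have "0 \<le> a (f i)" "0 \<le> b (f i)" "0 \<le> c (f i)" if "i \<in> N" for i
    using pos[OF fM[OF that]] by auto
  ultimately have "config 0 0 0 B C (\<lambda>i. {f i})"
    by (intro configI) (use B C in auto)
  then show ?thesis
    unfolding reach_def using B C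
    by (intro exI[of _ 0] exI[of _ B] exI[of _ C] exI[of _ "\<lambda>i. {f i}"] conjI)
qed

end

section \<open>Perturbation to positive weights without ties\<close>

text \<open>Small multiples of distinct powers of two are added. Uniqueness of binary expansions
  separates all sets, while strict comparisons under \<open>w\<close> survive. Hence weak
  comparisons carry back from \<open>w'\<close> to \<open>w\<close>, the direction in which EFX is
  transferred.\<close>

lemma generic_weights:
  fixes w :: "'g \<Rightarrow> real"
  assumes "finite M" "\<And>g. g \<in> M \<Longrightarrow> 0 \<le> w g"
  obtains w' :: "'g \<Rightarrow> real" where "\<And>g. g \<in> M \<Longrightarrow> 0 < w' g" "inj_on (sum w') (Pow M)"
    "\<And>S T. S \<subseteq> M \<Longrightarrow> T \<subseteq> M \<Longrightarrow> sum w' S \<le> sum w' T \<Longrightarrow> sum w S \<le> sum w T"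
proof -
  obtain f :: "'g \<Rightarrow> nat" where f: "inj_on f M"
    using finite_imp_inj_to_nat_seg[OF assms(1)] by blast
  define n where "n S = real (\<Sum>g\<in>S. 2 ^ f g)" for S
  have n_inj: "S = T" if "S \<subseteq> M" "T \<subseteq> M" "n S = n T" for S T
  proof -
    have enc: "(\<Sum>g\<in>U. 2 ^ f g) = set_encode (f ` U)" if "U \<subseteq> M" for U
      unfolding set_encode_def using sum.reindex[of f U "(^) (2::nat)"] inj_on_subset[OF f that] by simp
    have eq: "set_encode (f ` S) = set_encode (f ` T)"
      using that(3) enc[OF that(1)] enc[OF that(2)] unfolding n_def by simp
    have "finite (f ` S)" "finite (f ` T)"
      using finite_subset[OF that(1) assms(1)] finite_subset[OF that(2) assms(1)] by auto
    then have "f ` S = f ` T" using set_encode_eq eq by simp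
    then show "S = T" using inj_on_image_eq_iff[OF f that(1,2)] by simp
  qed
  have n_mono: "0 \<le> n S \<and> n S \<le> n M" if "S \<subseteq> M" for S
    unfolding n_def using that assms(1) by (auto intro!: sum_mono2 sum_nonneg)
  \<comment> \<open>The positive gaps between bundle values; the element \<open>1\<close> keeps the
    set nonempty when there is no such gap.\<close>
  define D where "D = insert 1 {d \<in> (\<lambda>(S, T). sum w T - sum w S) ` (Pow M \<times> Pow M). 0 < d}"
  have finD: "finite D" unfolding D_def using assms(1) by simp
  define \<delta> where "\<delta> = Min D"
  have dpos: "0 < \<delta>" unfolding \<delta>_def using finD by (subst Min_gr_iff) (auto simp: D_def)
  \<comment> \<open>With this choice the whole perturbation of a bundle is below the smallest gap;
    the summand \<open>1\<close> avoids division by zero.\<close>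
  define \<epsilon> where "\<epsilon> = \<delta> / (n M + 1)"
  have nM: "0 \<le> n M" using n_mono[of M] by simp
  have epos: "0 < \<epsilon>" unfolding \<epsilon>_def using dpos nM by simp
  define w' where "w' g = w g + \<epsilon> * 2 ^ f g" for g
  have sum_w': "sum w' S = sum w S + \<epsilon> * n S" for S
    unfolding w'_def n_def by (simp add: sum.distrib sum_distrib_left)
  have strict: "sum w' S < sum w' T" if ST: "S \<subseteq> M" "T \<subseteq> M" "sum w S < sum w T" for S T
  proof -
    have "sum w T - sum w S \<in> D" unfolding D_def using ST by (auto intro!: image_eqI[of _ _ "(S, T)"])
    then have "\<delta> \<le> sum w T - sum w S" unfolding \<delta>_def using finD by (intro Min_le) auto
    moreover have "\<epsilon> * n S < \<epsilon> * (n M + 1)" using n_mono[OF ST(1)] epos by (intro mult_strict_left_mono) auto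
    moreover have "\<epsilon> * (n M + 1) = \<delta>" unfolding \<epsilon>_def using nM by simp
    moreover have "0 \<le> \<epsilon> * n T" using n_mono[OF ST(2)] epos by simp
    ultimately show ?thesis unfolding sum_w' by linarith
  qed
  have mono: "sum w S \<le> sum w T" if "S \<subseteq> M" "T \<subseteq> M" "sum w' S \<le> sum w' T" for S T
    using strict[OF that(2,1)] that(3) by linarith
  show thesis
  proof (rule that)
    show "0 < w' g" if "g \<in> M" for g
      unfolding w'_def using assms(2)[OF that] epos by (simp add: add_nonneg_pos)
    show "inj_on (sum w') (Pow M)"
    proof (rule inj_onI)
      fix S T assume ST: "S \<in> Pow M" "T \<in> Pow M" "sum w' S = sum w' T"
      then have "sum w S = sum w T" using mono[of S T] mono[of T S] by auto
      then have "n S = n T" using ST(3) epos unfolding sum_w' by simp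
      then show "S = T" using n_inj ST by blast
    qed
  qed (rule mono)
qed

section \<open>Types of agents and the final allocation\<close>

lemma additive_valuationD:
  assumes "additive_valuation M v" "S \<subseteq> M"
  shows "0 \<le> v S" "v S = (\<Sum>g\<in>S. v {g})"
  using assms unfolding additive_valuation_def valuation_def by blast+

lemma common_weights:
  fixes v :: "'a \<Rightarrow> 'g set \<Rightarrow> real"
  assumes av: "\<And>i. i \<in> G \<Longrightarrow> additive_valuation M (v i)"
    and same: "\<And>i j S. i \<in> G \<Longrightarrow> j \<in> G \<Longrightarrow> S \<subseteq> M \<Longrightarrow> v i S = v j S"
  shows "\<exists>w. (\<forall>g\<in>M. 0 \<le> w g) \<and> (\<forall>i\<in>G. \<forall>S\<subseteq>M. v i S = sum w S)"
proof (cases "G = {}")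
  case True
  then show ?thesis by (intro exI[of _ "\<lambda>_. 0"]) simp
next
  case False
  then obtain i0 where i0: "i0 \<in> G" by blast
  show ?thesis
  proof (rule exI[of _ "\<lambda>g. v i0 {g}"], intro conjI ballI allI impI)
    show "0 \<le> v i0 {g}" if "g \<in> M" for g
      by (rule additive_valuationD(1)[OF av[OF i0]]) (use that in simp)
    show "v i S = (\<Sum>g\<in>S. v i0 {g})" if "i \<in> G" "S \<subseteq> M" for i S
      by (rule trans[OF same[OF that(1) i0 that(2)] additive_valuationD(2)[OF av[OF i0] that(2)]])
  qed
qed

text \<open>Missing groups are filled up with empty ones. A group of the partition is placed first,
  hence nonempty, because the induction needs an agent of type \<open>a\<close>.\<close>

lemma three_groups:
  assumes "at_most_types 3 N M v" "N \<noteq> {}"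
  obtains A B C where "A \<union> B \<union> C = N" "A \<inter> B = {}" "A \<inter> C = {}" "B \<inter> C = {}" "A \<noteq> {}"
    "\<And>G i j S. G \<in> {A, B, C} \<Longrightarrow> i \<in> G \<Longrightarrow> j \<in> G \<Longrightarrow> S \<subseteq> M \<Longrightarrow> v i S = v j S"
proof -
  obtain P where P: "partition_on N P" "finite P" "card P \<le> 3"
    "\<forall>G\<in>P. \<forall>i\<in>G. \<forall>j\<in>G. \<forall>S\<subseteq>M. v i S = v j S"
    using assms(1) unfolding at_most_types_def by (elim exE conjE)
  have same: "v i S = v j S" if "G \<in> P" "i \<in> G" "j \<in> G" "S \<subseteq> M" for G i j S
    using P(4)[THEN bspec, OF that(1), THEN bspec, OF that(2), THEN bspec, OF that(3)] that(4) by blast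
  have U: "\<Union> P = N" "{} \<notin> P" and dis: "\<And>G H. G \<in> P \<Longrightarrow> H \<in> P \<Longrightarrow> G \<noteq> H \<Longrightarrow> G \<inter> H = {}"
    using P(1) unfolding partition_on_def disjoint_def by auto
  have "P \<noteq> {}" using U assms(2) by auto
  then have "card P \<noteq> 0" using P(2) by simp
  then have "card P = 1 \<or> card P = 2 \<or> card P = 3" using P(3) by arith
  then show thesis
  proof (elim disjE)
    assume "card P = 1"
    then obtain A where A: "P = {A}" by (rule card_1_singletonE)
    show thesis
    proof (rule that[of A "{}" "{}"])
      show "v i S = v j S" if "G \<in> {A, {}, {}}" "i \<in> G" "j \<in> G" "S \<subseteq> M" for G i j S
        by (rule same[OF _ that(2-4)]) (use that(1,2) A in auto)
    qed (use A U in auto)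
  next
    assume "card P = 2"
    then obtain A B where A: "P = {A, B}" "A \<noteq> B" by (auto simp: card_2_iff)
    show thesis
    proof (rule that[of A B "{}"])
      show "v i S = v j S" if "G \<in> {A, B, {}}" "i \<in> G" "j \<in> G" "S \<subseteq> M" for G i j S
        by (rule same[OF _ that(2-4)]) (use that(1,2) A in auto)
    qed (use A U dis in auto)
  next
    assume "card P = 3"
    then obtain A B C where A: "P = {A, B, C}" "A \<noteq> B" "A \<noteq> C" "B \<noteq> C" by (auto simp: card_3_iff)
    show thesis
    proof (rule that[of A B C])
      show "v i S = v j S" if "G \<in> {A, B, C}" "i \<in> G" "j \<in> G" "S \<subseteq> M" for G i j S
        by (rule same[OF _ that(2-4)]) (use that(1) A in auto)
    qed (use A U dis in auto)
  qed
qed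

text \<open>Each good goes to an agent of its own, so removing a good from a bundle leaves nothing
  to envy.\<close>

lemma EFX_few_goods:
  assumes "finite N" "finite M" "card M < card N"
    and av: "\<And>i. i \<in> N \<Longrightarrow> additive_valuation M (v i)"
  shows "\<exists>X. allocation N M X \<and> EFX N v X"
proof -
  obtain f where f: "f ` M \<subseteq> N" "inj_on f M" using card_le_inj[OF assms(2,1)] assms(3) by auto
  define X where "X i = {g \<in> M. f g = i}" for i
  have "allocation N M X"
    unfolding allocation_def disjoint_family_on_def X_def using f(1) by auto
  moreover have "v i (X j - {g}) \<le> v i (X i)" if "i \<in> N" "g \<in> X j" for i j g
  proof -
    have empty: "X j - {g} = {}" using that(2) f(2) unfolding X_def by (auto dest: inj_onD)
    moreover have "v i {} = 0" using additive_valuationD(2)[OF av[OF that(1)], of "{}"] by simp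
    moreover have "0 \<le> v i (X i)"
      by (rule additive_valuationD(1)[OF av[OF that(1)]]) (auto simp: X_def)
    ultimately show ?thesis by (simp only: empty)
  qed
  ultimately show ?thesis unfolding EFX_def by blast
qed

theorem theorem1:
  fixes N :: "'a set" and M :: "'g set" and v :: "'a \<Rightarrow> 'g set \<Rightarrow> real"
  assumes "finite N" and "card N \<ge> 1" and "finite M"
    and "\<And>i. i \<in> N \<Longrightarrow> additive_valuation M (v i)"
    and "at_most_types 3 N M v"
  shows "\<exists>X. allocation N M X \<and> EFX N v X"
proof (cases "card M < card N")
  \<comment> \<open>Configurations consist of nonempty bundles, so too few goods must be treated
    apart.\<close>
  case True
  then show ?thesis using EFX_few_goods assms(1,3,4) by blast
next
  case False
  have "N \<noteq> {}" using assms(2) by auto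
  then obtain A B C where N: "A \<union> B \<union> C = N" and dis: "A \<inter> B = {}" "A \<inter> C = {}" "B \<inter> C = {}"
    and A0: "A \<noteq> {}"
    and same: "\<And>G i j S. G \<in> {A, B, C} \<Longrightarrow> i \<in> G \<Longrightarrow> j \<in> G \<Longrightarrow> S \<subseteq> M \<Longrightarrow> v i S = v j S"
    using three_groups[OF assms(5)] by metis
  have fin: "finite A" "finite B" "finite C" using assms(1) N by auto
  have weights: "\<exists>w :: 'g \<Rightarrow> real. (\<forall>g\<in>M. 0 < w g) \<and> inj_on (sum w) (Pow M) \<and>
      (\<forall>i\<in>G. \<forall>S\<subseteq>M. \<forall>T\<subseteq>M. sum w S \<le> sum w T \<longrightarrow> v i S \<le> v i T)"
    if G: "G \<in> {A, B, C}" for G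
  proof -
    have av: "additive_valuation M (v i)" if "i \<in> G" for i using assms(4)[of i] N G that by auto
    have "\<exists>u. (\<forall>g\<in>M. 0 \<le> u g) \<and> (\<forall>i\<in>G. \<forall>S\<subseteq>M. v i S = sum u S)"
      by (rule common_weights) (auto intro: av same[OF G])
    then obtain u where u': "\<forall>g\<in>M. 0 \<le> u g" "\<forall>i\<in>G. \<forall>S\<subseteq>M. v i S = sum u S" by (elim exE conjE)
    then have u: "\<And>g. g \<in> M \<Longrightarrow> 0 \<le> u g" by blast
    obtain w :: "'g \<Rightarrow> real" where w: "\<And>g. g \<in> M \<Longrightarrow> 0 < w g" "inj_on (sum w) (Pow M)"
      "\<And>S T. S \<subseteq> M \<Longrightarrow> T \<subseteq> M \<Longrightarrow> sum w S \<le> sum w T \<Longrightarrow> sum u S \<le> sum u T"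
      by (rule generic_weights[OF assms(3) u]) blast+
    have vw: "v i S \<le> v i T" if "i \<in> G" "S \<subseteq> M" "T \<subseteq> M" "sum w S \<le> sum w T" for i S T
      using w(3)[OF that(2-4)] u'(2) that(1-3) by simp
    show ?thesis
      by (rule exI[of _ w], intro conjI ballI allI impI) (use w(1,2) vw in blast)+
  qed
  obtain a :: "'g \<Rightarrow> real" where a: "\<forall>g\<in>M. 0 < a g" "inj_on (sum a) (Pow M)"
    "\<forall>i\<in>A. \<forall>S\<subseteq>M. \<forall>T\<subseteq>M. sum a S \<le> sum a T \<longrightarrow> v i S \<le> v i T"
    using weights[of A, simplified] by (elim exE conjE)
  obtain b :: "'g \<Rightarrow> real" where b: "\<forall>g\<in>M. 0 < b g" "inj_on (sum b) (Pow M)"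
    "\<forall>i\<in>B. \<forall>S\<subseteq>M. \<forall>T\<subseteq>M. sum b S \<le> sum b T \<longrightarrow> v i S \<le> v i T"
    using weights[of B, simplified] by (elim exE conjE)
  obtain c :: "'g \<Rightarrow> real" where c: "\<forall>g\<in>M. 0 < c g" "inj_on (sum c) (Pow M)"
    "\<forall>i\<in>C. \<forall>S\<subseteq>M. \<forall>T\<subseteq>M. sum c S \<le> sum c T \<longrightarrow> v i S \<le> v i T"
    using weights[of C, simplified] by (elim exE conjE)
  interpret three_valuations M N a b c
    using assms(1,3) a(1,2) b(1,2) c(1,2) by unfold_locales auto
  have cardN: "card N = card A + (card B + card C)"
  proof -
    have "card (B \<union> C) = card B + card C" using card_Un_disjoint fin dis by blast
    moreover have "card (A \<union> (B \<union> C)) = card A + card (B \<union> C)"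
      using fin dis by (intro card_Un_disjoint) auto
    ultimately show ?thesis using N by (simp add: Un_assoc)
  qed
  have lt: "card B + card C < card N" using cardN A0 fin by (simp add: card_gt_0_iff)
  have "reach (card B) (card C) 0" using reach_singletons False lt by simp
  from full_from_partial[OF this lt] obtain \<alpha> where "reach_full (card B) (card C) \<alpha>" by blast
  then obtain \<beta> \<gamma> B' C' X where cf: "config \<alpha> \<beta> \<gamma> B' C' X" and card: "card B' = card B" "card C' = card C"
    and full: "(\<Union>i\<in>N. X i) = M" unfolding reach_full_def by blast
  have bd: "bundles \<alpha> \<beta> \<gamma> X" and sub: "B' \<subseteq> N" "C' \<subseteq> N" "B' \<inter> C' = {}"
    and good: "\<And>i. i \<in> N - B' - C' \<Longrightarrow> \<alpha> \<le> sum a (X i)"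
      "\<And>i. i \<in> B' \<Longrightarrow> \<beta> \<le> sum b (X i)" "\<And>i. i \<in> C' \<Longrightarrow> \<gamma> \<le> sum c (X i)"
    using cf unfolding config_def by auto
  have fin': "finite B'" "finite C'" using sub assms(1) finite_subset by blast+
  have "C' \<subseteq> N - B'" using sub by blast
  then have "card (N - B' - C') = card N - card B' - card C'"
    using card_Diff_subset[OF fin'(2)] card_Diff_subset[OF fin'(1) sub(1)] by simp
  then have cardA: "card A = card (N - B' - C')" using cardN card by simp
  obtain p where p: "bij_betw p A (N - B' - C')"
    using finite_same_card_bij[OF fin(1) _ cardA] assms(1) by blast
  obtain q where q: "bij_betw q B B'" using finite_same_card_bij[OF fin(2) fin'(1) card(1)[symmetric]] by blast
  obtain r where r: "bij_betw r C C'" using finite_same_card_bij[OF fin(3) fin'(2) card(2)[symmetric]] by blast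
  \<comment> \<open>The configuration has the right number of bundles of each type, but not at the
    indices of the agents of that type. The permutation \<open>s\<close> of \<open>N\<close> gives
    every agent a bundle of the right type.\<close>
  define s where "s i = (if i \<in> A then p i else if i \<in> B then q i else r i)" for i
  have sA: "bij_betw s A (N - B' - C')" using p by (rule bij_betw_cong[THEN iffD1, rotated]) (simp add: s_def)
  have sB: "bij_betw s B B'" using q by (rule bij_betw_cong[THEN iffD1, rotated]) (use dis in \<open>auto simp: s_def\<close>)
  have sC: "bij_betw s C C'" using r by (rule bij_betw_cong[THEN iffD1, rotated]) (use dis in \<open>auto simp: s_def\<close>)
  have "bij_betw s (A \<union> B \<union> C) (N - B' - C' \<union> B' \<union> C')"
    by (intro bij_betw_combine sA sB sC) (use sub in auto)
  moreover have "N - B' - C' \<union> B' \<union> C' = N" using sub by auto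
  ultimately have s: "bij_betw s N N" using N by simp
  have sN: "s i \<in> N" if "i \<in> N" for i using s that by (rule bij_betwE[THEN bspec])
  have "allocation N M (X \<circ> s)"
    unfolding allocation_def
  proof
    show "disjoint_family_on (X \<circ> s) N"
      unfolding disjoint_family_on_def
    proof (intro ballI impI)
      fix i j assume ij: "i \<in> N" "j \<in> N" "i \<noteq> j"
      then have "s i \<noteq> s j" using s by (auto simp: bij_betw_def dest: inj_onD)
      then show "(X \<circ> s) i \<inter> (X \<circ> s) j = {}" using bundlesD(4)[OF bd sN[OF ij(1)] sN[OF ij(2)]] by simp
    qed
    show "(\<Union>i\<in>N. (X \<circ> s) i) = M" using full bij_betw_imp_surj_on[OF s] by (metis image_comp)
  qed
  \<comment> \<open>The bound of the type of \<open>i\<close> separates the two values in the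
    perturbed weights; the comparison is then carried back to \<open>v i\<close>.\<close>
  moreover have "v i (X (s j) - {g}) \<le> v i (X (s i))" if iN: "i \<in> N" and "j \<in> N" "g \<in> X (s j)" for i j g
  proof -
    have M: "X (s i) \<subseteq> M" "X (s j) - {g} \<subseteq> M"
      using bundlesD(1)[OF bd sN[OF that(1)]] bundlesD(1)[OF bd sN[OF that(2)]] by auto
    have le: "sum a (X (s j) - {g}) \<le> \<alpha>" "sum b (X (s j) - {g}) \<le> \<beta>" "sum c (X (s j) - {g}) \<le> \<gamma>"
      using bundlesD(3)[OF bd sN[OF that(2)]] that(3) unfolding safe_def by auto
    consider "i \<in> A" | "i \<in> B" | "i \<in> C" using iN N by blast
    then show ?thesis
    proof cases
      case 1
      then have "\<alpha> \<le> sum a (X (s i))" using good(1) bij_betwE[OF sA] by blast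
      then show ?thesis using a(3) 1 M le(1) by (meson order_trans)
    next
      case 2
      then have "\<beta> \<le> sum b (X (s i))" using good(2) bij_betwE[OF sB] by blast
      then show ?thesis using b(3) 2 M le(2) by (meson order_trans)
    next
      case 3
      then have "\<gamma> \<le> sum c (X (s i))" using good(3) bij_betwE[OF sC] by blast
      then show ?thesis using c(3) 3 M le(3) by (meson order_trans)
    qed
  qed
  ultimately show ?thesis unfolding EFX_def by (intro exI[of _ "X \<circ> s"]) simp
qed

end
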